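(* Let $q$ be an odd prime power not in the set $\{3, 5, 7, 9, 11, 13, 17, 19, 23, 25, 27, 29, 31, 37, 41, 43, 47, 49, 53, 59, 61, 67, 71, 73, 79, 81, 83, 89, 97, 101, 103, 109, 113, 121, 125, 127, 131, 137, 139, 149, 151, 157, 169, 173, 181, 191, 197, 199, 211, 229, 239, 241, 269, 281, 307, 311, 331, 337, 349, 361, 373, 379, 389, 409, 419, 421, 461, 463, 509, 521, 529, 569, 571, 601, 617, 631, 659, 661, 701, 761, 769, 841, 859, 881, 911, 1009, 1021, 1231, 1289, 1301, 1331, 1429, 1609, 1741, 1849, 1861, 2029, 2281, 2311, 2729, 3541\}$. Then for every $\beta\in\mathbb{F}_q^*$ there exists a $2$-primitive $\xi\in\mathbb{F}_{q^2}$ with $\mathrm{Tr}(\xi)=\beta$.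
   Context: An element of $\mathbb{F}_{q^2}$ is $2$-primitive if its multiplicative order is $(q^2-1)/2$. $\mathrm{Tr}(\xi)=\xi+\xi^q$. *)

theory Defs
  imports "HOL-Algebra.Algebra" "HOL-Number_Theory.Prime_Powers"
begin

text \<open>
  Throughout, \<open>F\<close> is a field with \<open>q\<^sup>2\<close> elements. The number \<open>(q\<^sup>2 - 1) div 2\<close> below is
  an exact quotient for odd \<open>q\<close>.
\<close>

definition two_primitive :: "('a, 'b) ring_scheme \<Rightarrow> nat \<Rightarrow> 'a \<Rightarrow> bool" where
  "two_primitive F q x \<longleftrightarrow>
     x \<in> carrier (mult_of F) \<and> group.ord (mult_of F) x = (q\<^sup>2 - 1) div 2"

definition quad_trace :: "('a, 'b) ring_scheme \<Rightarrow> nat \<Rightarrow> 'a \<Rightarrow> 'a" where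
  "quad_trace F q x = x \<oplus>\<^bsub>F\<^esub> x [^]\<^bsub>F\<^esub> q"

definition exceptional_q :: "nat set" where
  "exceptional_q =
     {3, 5, 7, 9, 11, 13, 17, 19, 23, 25, 27, 29, 31, 37, 41, 43, 47, 49, 53, 59, 61, 67, 71,
      73, 79, 81, 83, 89, 97, 101, 103, 109, 113, 121, 125, 127, 131, 137, 139, 149, 151, 157,
      169, 173, 181, 191, 197, 199, 211, 229, 239, 241, 269, 281, 307, 311, 331, 337, 349, 361,
      373, 379, 389, 409, 419, 421, 461, 463, 509, 521, 529, 569, 571, 601, 617, 631, 659, 661,
      701, 761, 769, 841, 859, 881, 911, 1009, 1021, 1231, 1289, 1301, 1331, 1429, 1609, 1741,
      1849, 1861, 2029, 2281, 2311, 2729, 3541}"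

end

theory Submission
  imports Defs "HOL-Number_Theory.Cong" "HOL-Number_Theory.Pocklington"
begin

text \<open>
  Fix a generator $g$ of $F^*$ and put $Q = q^2 - 1$. The exponents $k$ modulo $Q$ with
  $\mathrm{Tr}(g^k) = \beta$ form a relative difference set: there are $q$ of them, and every residue that
  is not a multiple of $q + 1$ is a difference of exactly one pair, because the kernel of the trace is
  a line over $K$. Hence a nontrivial character sum over these exponents has absolute value $1$ or
  $\sqrt q$, according to whether the character is trivial on $K^*$. An exponent $k$ gives a
  2-primitive element iff $k \equiv 2$ modulo $4$ and no odd prime factor of $Q$ divides $k$; a linear
  sieve over the odd primes, with a few of them kept in the core, produces such a $k$ as soon as an
  explicit inequality in $q$ and the prime factors of $q \pm 1$ holds. For $q \ge 26000$ the inequality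
  follows from bounds on the number of prime factors of $Q$; below that it is checked by a computation
  that only tests divisibility by small primes and bounds the contribution of the others, except for
  26 prime powers where the complete factorisation is used.
\<close>

hide_const (open) Divisibility.prime

section \<open>Characters of a relative difference set\<close>

text \<open>Putting all n odd prime factors of \<open>q^2 - 1\<close> into the core would cost about
  \<open>4 * 2^n\<close> characters of size sqrt q, which only works for q with very many prime
  factors. Sieving a prime r costs just one more bound of size about
  \<open>num_chars C * sqrt q\<close>, but takes 1/r away from the factor d = 1 - sum 1/r, which has
  to stay positive. The prime 3 would take a third of it alone, so it is the natural core prime. No
  Gauss sums are needed: the squared absolute value of a character sum over the exponents depends
  only on their differences, and these are known exactly.

  The characters trivial on K^* are those of order dividing \<open>q + 1\<close>. Their better bound
  1 matters only for small q; the large range uses sqrt q for every character. The checker for small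
  q avoids factoring because below \<open>2 * 29^3\<close> an even number has at most two prime
  factors from 29 on, and counting them is almost always enough.\<close>

definition unity_char :: "int \<Rightarrow> int \<Rightarrow> complex" where
  "unity_char n x = cis (2 * pi * of_int x / of_int n)"

lemma norm_unity_char [simp]: "norm (unity_char n x) = 1"
  by (simp add: unity_char_def)

lemma unity_char_add: "unity_char n (x + y) = unity_char n x * unity_char n y"
  by (simp add: unity_char_def cis_mult add_divide_distrib distrib_left)

lemma unity_char_0 [simp]: "unity_char n 0 = 1"
  by (simp add: unity_char_def)

lemma cnj_unity_char: "cnj (unity_char n x) = unity_char n (- x)"
  by (simp add: unity_char_def cis_cnj)

lemma unity_char_eq_1_iff:
  assumes "n > 0"
  shows "unity_char n x = 1 \<longleftrightarrow> n dvd x"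
proof
  assume "n dvd x"
  then obtain k where "x = n * k" by (elim dvdE)
  then have "2 * pi * of_int x / of_int n = 2 * pi * of_int k"
    using assms by (simp add: field_simps)
  then show "unity_char n x = 1"
    unfolding unity_char_def by (simp only: cis_multiple_2pi Ints_of_int)
next
  assume "unity_char n x = 1"
  then have "cos (2 * pi * of_int x / of_int n) = 1"
    by (metis cis.sel(1) one_complex.sel(1) unity_char_def)
  then obtain k :: int where "2 * pi * of_int x / of_int n = of_int k * 2 * pi"
    by (metis cos_one_2pi_int)
  then have "real_of_int x = of_int (k * n)" using assms by (simp add: field_simps)
  then have "x = k * n" by (simp only: of_int_eq_iff)
  then show "n dvd x" by simp
qed

lemma unity_char_cong:
  assumes "n > 0" "n dvd x - y"
  shows "unity_char n x = unity_char n y"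
  using unity_char_add[of n "x - y" y] unity_char_eq_1_iff[OF assms(1)] assms(2) by simp

lemma unity_char_scale:
  assumes "m \<noteq> 0"
  shows "unity_char (n * m) (x * m) = unity_char n x"
  using assms by (simp add: unity_char_def mult.assoc)

lemma sum_unity_char:
  assumes "n > 0"
  shows "(\<Sum>t\<in>{0..<n}. unity_char n (t * j)) = (if n dvd j then of_int n else 0)"
proof (cases "n dvd j")
  case True
  then have "unity_char n (t * j) = 1" for t
    using unity_char_eq_1_iff[OF assms] by simp
  then show ?thesis using True assms by simp
next
  case False
  have pw: "unity_char n (int t * j) = unity_char n j ^ t" for t
    by (induction t) (simp_all add: distrib_right unity_char_add)
  have "(\<Sum>t\<in>{0..<n}. unity_char n (t * j)) = (\<Sum>t<nat n. unity_char n (int t * j))"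
    by (rule sum.reindex_bij_witness[of _ int nat]) auto
  also have "\<dots> = (unity_char n j ^ nat n - 1) / (unity_char n j - 1)"
    using False unity_char_eq_1_iff[OF assms] by (simp add: pw geometric_sum)
  also have "unity_char n j ^ nat n = 1"
    using pw[of "nat n"] unity_char_eq_1_iff[OF assms, of "n * j"] assms by simp
  finally show ?thesis using False by simp
qed

section \<open>The sieve inequality\<close>

definition odd_primes :: "nat \<Rightarrow> nat set" where
  "odd_primes q = {r. prime r \<and> r \<noteq> 2 \<and> r dvd q\<^sup>2 - 1}"

text \<open>
  \<open>C\<close> is a set of core primes, treated by inclusion-exclusion; the remaining odd primes are sieved.
  The core condition expands into \<open>num_chars C\<close> characters of $F^*$ after normalisation, of which
  \<open>num_trivial q C\<close> are trivial on $K^*$. A nontrivial character contributes at most $1$ if it is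
  trivial on $K^*$ and at most $\sqrt q$ otherwise.
\<close>
definition num_chars :: "nat set \<Rightarrow> real" where
  "num_chars C = 4 * 2 ^ card C"

definition num_trivial :: "nat \<Rightarrow> nat set \<Rightarrow> real" where
  "num_trivial q C = (if q mod 4 = 3 then 4 else 2) * 2 ^ card {r \<in> C. r dvd q + 1}"

definition mixed_bound :: "nat \<Rightarrow> nat set \<Rightarrow> real" where
  "mixed_bound q C = num_trivial q C + (num_chars C - num_trivial q C) * sqrt q"

text \<open>Characters of order r with \<open>r dvd q + 1\<close> are trivial on K^*, so a twist by
  one of them keeps the split of the core characters into two kinds. For r dividing
  \<open>q - 1\<close> the twist makes every term nontrivial on K^*.\<close>

definition char_bound :: "nat \<Rightarrow> nat set \<Rightarrow> nat \<Rightarrow> real" where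
  "char_bound q C r = (if r dvd q + 1 then mixed_bound q C else num_chars C * sqrt q)"

text \<open>The common factor \<open>core_density C\<close> has been divided out. The bracket on the
  right bounds the number of exponents passing the core from below; its \<open>+ 1\<close>
  compensates for the principal character, which \<open>mixed_bound q C\<close> counts with weight
  1. On the left is the excess of multiples of the sieved primes over their expected share.\<close>

definition sieve_criterion :: "nat \<Rightarrow> nat set \<Rightarrow> bool" where
  "sieve_criterion q C \<longleftrightarrow> C \<subseteq> odd_primes q \<and>
     (let S = odd_primes q - C; d = 1 - (\<Sum>r\<in>S. 1 / r) in
      d \<ge> 0 \<and> (\<Sum>r\<in>S. (1 - 1 / r) * char_bound q C r) < d * (q + 1 - mixed_bound q C))"

text \<open>These are the parameters \<open>(q + 1, q - 1, q, 1)\<close> of Bose's affine difference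
  sets. The forbidden subgroup, the multiples of \<open>q + 1\<close>, is the set of exponents of
  K^*. From here on the sieve needs only integers and no field.\<close>

locale relative_difference_set =
  fixes q :: nat and D :: "int set" and Q :: int
  assumes odd_q: "odd q" and q_gt_1: "q > 1"
    and finite_D: "finite D" and card_D: "card D = q"
    and Q_def: "Q = (int q)\<^sup>2 - 1"
    and differences: "bij_betw (\<lambda>(a, b). (a - b) mod Q) {(a, b) \<in> D \<times> D. a \<noteq> b}
                        {t \<in> {0..<Q}. \<not> (int q + 1) dvd t}"
begin

lemma Q_factor: "Q = (int q - 1) * (int q + 1)"
  unfolding Q_def by (simp add: power2_eq_square algebra_simps)

lemma Q_pos: "Q > 0"
  using q_gt_1 unfolding Q_factor by simp

lemma four_dvd_Q: "4 dvd Q"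
proof -
  have "2 dvd int q - 1" "2 dvd int q + 1" using odd_q by simp_all
  then have "2 * 2 dvd (int q - 1) * (int q + 1)" by (rule mult_dvd_mono)
  then show ?thesis unfolding Q_factor by simp
qed

definition line_sum :: "int \<Rightarrow> complex" where
  "line_sum j = (\<Sum>k\<in>D. unity_char Q (j * k))"

text \<open>Expanding the square gives q from the diagonal plus the character summed over all
  differences, that is over Z/Q without the forbidden subgroup. The full sum vanishes, and the sum
  over the subgroup, of order \<open>q - 1\<close>, is \<open>q - 1\<close> or 0. What remains is 1
  or q.\<close>

lemma norm_line_sum_squared:
  assumes "\<not> Q dvd j"
  shows "(norm (line_sum j))\<^sup>2 = (if (int q - 1) dvd j then 1 else q)"
proof -
  let ?e = "\<lambda>x. unity_char Q (j * x)"
  let ?N = "{t \<in> {0..<Q}. \<not> (int q + 1) dvd t}" and ?M = "{t \<in> {0..<Q}. (int q + 1) dvd t}"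
  have "complex_of_real ((norm (line_sum j))\<^sup>2) = line_sum j * cnj (line_sum j)"
    by (rule complex_norm_square)
  also have "\<dots> = (\<Sum>(a, b)\<in>D \<times> D. ?e (a - b))"
    unfolding line_sum_def
    by (simp add: cnj_sum sum_product sum.cartesian_product cnj_unity_char
        flip: unity_char_add) (simp add: algebra_simps)
  also have "D \<times> D = {(a, b) \<in> D \<times> D. a \<noteq> b} \<union> (\<lambda>a. (a, a)) ` D"
    by auto
  also have "(\<Sum>(a, b)\<in>\<dots>. ?e (a - b)) =
      (\<Sum>(a, b)\<in>{(a, b) \<in> D \<times> D. a \<noteq> b}. ?e (a - b)) + (\<Sum>(a, b)\<in>(\<lambda>a. (a, a)) ` D. ?e (a - b))"
    using finite_D by (intro sum.union_disjoint finite_subset[of "{(a, b) \<in> D \<times> D. a \<noteq> b}" "D \<times> D"]) auto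
  also have "(\<Sum>(a, b)\<in>(\<lambda>a. (a, a)) ` D. ?e (a - b)) = q"
    by (subst sum.reindex) (auto simp: inj_on_def card_D)
  also have "(\<Sum>(a, b)\<in>{(a, b) \<in> D \<times> D. a \<noteq> b}. ?e (a - b)) =
      (\<Sum>(a, b)\<in>{(a, b) \<in> D \<times> D. a \<noteq> b}. ?e ((a - b) mod Q))"
  proof (intro sum.cong refl, clarify)
    fix a b
    have "j * (a - b) - j * ((a - b) mod Q) = Q * (j * ((a - b) div Q))"
      by (simp add: minus_mod_eq_mult_div mult.left_commute flip: right_diff_distrib)
    then have "Q dvd j * (a - b) - j * ((a - b) mod Q)" by simp
    then show "?e (a - b) = ?e ((a - b) mod Q)" by (rule unity_char_cong[OF Q_pos])
  qed
  also have "\<dots> = (\<Sum>t\<in>?N. ?e t)"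
    using sum.reindex_bij_betw[OF differences, of ?e] by (simp add: case_prod_unfold)
  also have "\<dots> = (\<Sum>t\<in>{0..<Q}. ?e t) - (\<Sum>t\<in>?M. ?e t)"
  proof -
    have "{0..<Q} = ?N \<union> ?M" by auto
    then have "(\<Sum>t\<in>{0..<Q}. ?e t) = (\<Sum>t\<in>?N. ?e t) + (\<Sum>t\<in>?M. ?e t)"
      by (metis (no_types, lifting) finite_atLeastLessThan_int finite_Un sum.union_disjoint
          disjoint_iff mem_Collect_eq)
    then show ?thesis by simp
  qed
  also have "(\<Sum>t\<in>{0..<Q}. ?e t) = 0"
    using sum_unity_char[OF Q_pos, of j] assms by (simp add: mult.commute)
  \<comment> \<open>On the multiples \<open>i * (q + 1)\<close> a character modulo Q is a character
    modulo \<open>q - 1\<close> in i, so orthogonality applies again with the smaller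
    modulus.\<close>
  also have "(\<Sum>t\<in>?M. ?e t) = (\<Sum>i\<in>{0..<int q - 1}. unity_char (int q - 1) (i * j))"
  proof (rule sum.reindex_bij_witness[of _ "\<lambda>i. i * (int q + 1)" "\<lambda>t. t div (int q + 1)"])
    fix i assume i: "i \<in> {0..<int q - 1}"
    then have "i * (int q + 1) < Q" unfolding Q_factor by (intro mult_strict_right_mono) auto
    then show "i * (int q + 1) \<in> ?M" using i by simp
  next
    fix t assume t: "t \<in> ?M"
    then obtain s where s: "t = (int q + 1) * s" by (auto elim: dvdE)
    have "(int q + 1) * s < (int q + 1) * (int q - 1)" "0 \<le> (int q + 1) * s"
      using t unfolding Q_factor s by (auto simp: mult.commute)
    then have "s < int q - 1" "0 \<le> s"
      by (auto simp: mult_less_cancel_left zero_le_mult_iff)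
    then show "t div (int q + 1) \<in> {0..<int q - 1}" unfolding s by simp
    show "unity_char (int q - 1) (t div (int q + 1) * j) = ?e t"
      using unity_char_scale[of "int q + 1" "int q - 1" "s * j"]
      unfolding s Q_factor by (simp add: mult_ac)
  qed (use q_gt_1 in auto)
  also have "\<dots> = (if (int q - 1) dvd j then of_int (int q - 1) else 0)"
    using sum_unity_char[of "int q - 1" j] q_gt_1 by simp
  finally have "complex_of_real ((norm (line_sum j))\<^sup>2) =
      complex_of_real (if (int q - 1) dvd j then 1 else q)"
    by auto
  then show ?thesis by (simp only: of_real_eq_iff)
qed

lemma line_sum_0: "line_sum 0 = q"
  by (simp add: line_sum_def card_D)

lemma norm_line_sum_nontrivial:
  assumes "\<not> (int q - 1) dvd j"
  shows "norm (line_sum j) = sqrt q"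
proof -
  have "\<not> Q dvd j" using assms unfolding Q_factor by (metis dvd_mult_left)
  then show ?thesis using norm_line_sum_squared[of j] assms by (simp add: real_sqrt_unique)
qed

lemma norm_line_sum_trivial:
  assumes "\<not> Q dvd j" "(int q - 1) dvd j"
  shows "norm (line_sum j) = 1"
  using norm_line_sum_squared[OF assms(1)] assms(2) norm_ge_zero[of "line_sum j"]
  by (simp add: power2_eq_1_iff)

lemma norm_line_sum_le:
  assumes "\<not> Q dvd j"
  shows "norm (line_sum j) \<le> sqrt q"
  using norm_line_sum_nontrivial[of j] norm_line_sum_trivial[OF assms] q_gt_1
  by (cases "(int q - 1) dvd j") auto

end

section \<open>The sieve\<close>

lemma dvd_indicator:
  assumes "n > 0"
  shows "(if n dvd k then 1 else 0) = (\<Sum>i\<in>{0..<n}. unity_char n (i * k)) / of_int n"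
  using assms by (simp add: sum_unity_char)

lemma odd_primesD:
  assumes "r \<in> odd_primes q"
  shows "prime r" "odd r" "r dvd q\<^sup>2 - 1"
  using assms primes_dvd_imp_eq[of 2 r] by (auto simp: odd_primes_def)

lemma finite_odd_primes: "q > 1 \<Longrightarrow> finite (odd_primes q)"
proof -
  assume "q > 1"
  then have "q\<^sup>2 - 1 > 0" by (simp add: power2_eq_square one_less_mult)
  then have "finite {r. r dvd q\<^sup>2 - 1}" by simp
  then show ?thesis by (rule finite_subset[rotated]) (auto simp: odd_primes_def)
qed

definition core_density :: "nat set \<Rightarrow> real" where
  "core_density C = (\<Prod>r\<in>C. 1 - 1 / r) / 4"

definition core :: "nat set \<Rightarrow> int \<Rightarrow> complex" where
  "core C k = (if k mod 4 = 2 \<and> (\<forall>r\<in>C. \<not> int r dvd k) then 1 else 0)"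

text \<open>The characters in the Fourier expansion of \<open>core C\<close> are those of order
  dividing this number. Thus \<open>Q dvd j * modulus C\<close> says that the j-th character of Z/Q
  is one of them.\<close>

definition modulus :: "nat set \<Rightarrow> int" where
  "modulus C = 4 * (\<Prod>r\<in>C. int r)"

lemma num_trivial_le: 
  assumes "finite C"
  shows "num_trivial q C \<le> num_chars C"
proof -
  have "card {r \<in> C. r dvd q + 1} \<le> card C" using assms by (intro card_mono) auto
  then have "(2::real) ^ card {r \<in> C. r dvd q + 1} \<le> 2 ^ card C"
    by (intro power_increasing) auto
  then show ?thesis unfolding num_trivial_def num_chars_def by (intro mult_mono) auto
qed

lemma num_trivial_ge_1: "1 \<le> num_trivial q C"
proof -
  have "(1::real) \<le> 2 ^ card {r \<in> C. r dvd q + 1}" by simp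
  then show ?thesis unfolding num_trivial_def by (smt (verit) mult_cancel_right1 mult_right_mono)
qed

lemma mixed_bound_le:
  assumes "finite C" "q \<ge> 1"
  shows "mixed_bound q C \<le> num_chars C * sqrt q"
proof -
  have "num_trivial q C * 1 \<le> num_trivial q C * sqrt q"
    using assms num_trivial_ge_1[of q C] by (intro mult_left_mono) auto
  then show ?thesis unfolding mixed_bound_def by (simp add: algebra_simps)
qed

context relative_difference_set begin

definition twisted_sum :: "nat set \<Rightarrow> int \<Rightarrow> complex" where
  "twisted_sum C j = (\<Sum>k\<in>D. core C k * unity_char Q (j * k))"

lemma prime_dvd_Q:
  assumes "r \<in> odd_primes q"
  shows "int r dvd Q"
proof -
  have "int (q\<^sup>2 - 1) = Q" using q_gt_1 unfolding Q_def by (simp add: of_nat_diff)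
  then show ?thesis using odd_primesD(3)[OF assms] by (metis int_dvd_int_iff)
qed

lemma prime_dvd_cases:
  assumes "r \<in> odd_primes q"
  obtains (plus) "r dvd q + 1" "int r dvd int q + 1" "\<not> int r dvd int q - 1"
  | (minus) "\<not> r dvd q + 1" "\<not> int r dvd int q + 1" "int r dvd int q - 1"
proof -
  have iff: "r dvd q + 1 \<longleftrightarrow> int r dvd int q + 1"
    by (metis int_dvd_int_iff of_nat_1 of_nat_add)
  have "prime (int r)" using odd_primesD[OF assms] by simp
  then have "int r dvd int q - 1 \<or> int r dvd int q + 1"
    using prime_dvd_Q[OF assms] unfolding Q_factor by (simp add: prime_dvd_mult_iff)
  moreover have "\<not> (int r dvd int q - 1 \<and> int r dvd int q + 1)"
  proof
    assume "int r dvd int q - 1 \<and> int r dvd int q + 1"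
    then have "int r dvd (int q + 1) - (int q - 1)" using dvd_diff by blast
    then have "int r dvd int 2" by simp
    then have "r dvd 2" by (simp only: int_dvd_int_iff)
    then show False using odd_primesD[OF assms]
      by (metis primes_dvd_imp_eq two_is_prime_nat dvd_refl)
  qed
  ultimately show thesis using that iff by blast
qed

section \<open>Fourier expansion of the core condition\<close>

lemma core_insert:
  "core (insert r C) k = core C k - (if int r dvd k then core C k else 0)"
  by (auto simp: core_def)

lemma dvd_indicator_Q:
  assumes "n > 0" "n dvd Q"
  shows "(if n dvd k then 1 else 0) = (\<Sum>i\<in>{0..<n}. unity_char Q (i * (Q div n) * k)) / of_int n"
proof -
  obtain m where m: "Q = n * m" using assms by (elim dvdE)
  then have "m \<noteq> 0" using Q_pos by auto
  then have "unity_char n (i * k) = unity_char Q (i * (Q div n) * k)" for i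
    using unity_char_scale[of m n "i * k"] assms m by (simp add: mult_ac)
  then show ?thesis using dvd_indicator[OF assms(1)] by simp
qed

lemma twisted_sum_multiples:
  assumes "r \<in> odd_primes q"
  shows "(\<Sum>k\<in>D. if int r dvd k then core C k * unity_char Q (j * k) else 0) =
    (\<Sum>i\<in>{0..<int r}. twisted_sum C (j + i * (Q div r))) / r"
proof -
  have r: "int r > 0" using odd_primesD(1)[OF assms] prime_gt_0_nat by simp
  have "(if int r dvd k then core C k * unity_char Q (j * k) else 0) =
     (\<Sum>i\<in>{0..<int r}. core C k * unity_char Q ((j + i * (Q div r)) * k)) / r" for k
  proof -
    have "(if int r dvd k then core C k * unity_char Q (j * k) else 0) =
       core C k * unity_char Q (j * k) * (if int r dvd k then 1 else 0)" by simp
    also have "\<dots> = (\<Sum>i\<in>{0..<int r}. core C k * unity_char Q (j * k + i * (Q div r) * k)) / r"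
      unfolding dvd_indicator_Q[OF r prime_dvd_Q[OF assms]] unity_char_add
      by (simp add: sum_distrib_left mult_ac)
    finally show ?thesis by (simp add: distrib_right)
  qed
  then show ?thesis
    unfolding twisted_sum_def by (simp add: sum_divide_distrib sum.swap[of _ _ D])
qed

text \<open>Inclusion-exclusion one prime at a time: the indicator of r dividing k is the average of
  the r characters of order dividing r, and each of them only shifts the frequency j. The term i = 0
  is merged with the old sum, which makes the expected density \<open>1 - 1 / r\<close>
  visible.\<close>

lemma twisted_sum_insert:
  assumes "r \<in> odd_primes q"
  shows "twisted_sum (insert r C) j =
    (1 - 1 / r) * twisted_sum C j - (\<Sum>i\<in>{1..<int r}. twisted_sum C (j + i * (Q div r))) / r"
proof -
  have r: "int r > 0" using odd_primesD(1)[OF assms] prime_gt_0_nat by simp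
  have split: "{0..<int r} = insert 0 {1..<int r}" using r by auto
  have "twisted_sum (insert r C) j = (\<Sum>k\<in>D. core C k * unity_char Q (j * k) -
      (if int r dvd k then core C k * unity_char Q (j * k) else 0))"
    unfolding twisted_sum_def core_insert by (intro sum.cong) (auto simp: algebra_simps)
  also have "\<dots> = twisted_sum C j - (\<Sum>i\<in>{0..<int r}. twisted_sum C (j + i * (Q div r))) / r"
    unfolding sum_subtractf twisted_sum_multiples[OF assms] by (simp add: twisted_sum_def)
  finally show ?thesis unfolding split by (simp add: algebra_simps add_divide_distrib)
qed

lemma norm_shifts_le:
  assumes r: "r \<in> odd_primes q"
    and "\<And>i. i \<in> {1..<int r} \<Longrightarrow> norm (twisted_sum C (j + i * (Q div r))) \<le> b"
  shows "norm ((\<Sum>i\<in>{1..<int r}. twisted_sum C (j + i * (Q div r))) / r) \<le> (1 - 1 / r) * b"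
proof -
  have r: "r > 0" using odd_primesD(1)[OF assms(1)] prime_gt_0_nat by simp
  have "norm (\<Sum>i\<in>{1..<int r}. twisted_sum C (j + i * (Q div r))) \<le> real (card {1..<int r}) * b"
    using assms(2) by (intro order.trans[OF norm_sum] sum_bounded_above) auto
  also have "real (card {1..<int r}) = real r - 1" using r by (simp add: of_nat_diff)
  finally show ?thesis using r by (simp add: norm_divide field_simps)
qed

lemma twisted_sum_empty:
  "twisted_sum {} j = (\<Sum>i\<in>{0..<4}. unity_char 4 (- 2 * i) * line_sum (j + i * (Q div 4))) / 4"
proof -
  have c: "core {} k = (\<Sum>i\<in>{0..<4}. unity_char 4 (- 2 * i) * unity_char Q (i * (Q div 4) * k)) / 4" for k
  proof -
    obtain m where m: "Q = 4 * m" using four_dvd_Q by (elim dvdE)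
    then have "m \<noteq> 0" using Q_pos by auto
    then have e: "unity_char 4 (i * k) = unity_char Q (i * (Q div 4) * k)" for i
      using unity_char_scale[of m 4 "i * k"] m by (simp add: mult_ac)
    have "core {} k = (if 4 dvd k - 2 then 1 else 0)"
      unfolding core_def by (simp add: mod_eq_dvd_iff[of k 4 2, simplified])
    also have "\<dots> = (\<Sum>i\<in>{0..<4}. unity_char 4 (i * (k - 2))) / 4"
      using dvd_indicator[of 4 "k - 2"] by simp
    also have "(\<lambda>i. unity_char 4 (i * (k - 2))) = (\<lambda>i. unity_char 4 (- 2 * i) * unity_char Q (i * (Q div 4) * k))"
      unfolding e[symmetric] unity_char_add[symmetric] by (simp add: algebra_simps)
    finally show ?thesis .
  qed
  have "core {} k * unity_char Q (j * k) = (\<Sum>i\<in>{0..<4}. unity_char 4 (- 2 * i) *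
      unity_char Q ((j + i * (Q div 4)) * k)) / 4" for k
    unfolding c distrib_right unity_char_add
    by (simp add: sum_distrib_right sum_distrib_left sum_divide_distrib mult_ac)
  then have "twisted_sum {} j = (\<Sum>k\<in>D. (\<Sum>i\<in>{0..<4}. unity_char 4 (- 2 * i) *
      unity_char Q ((j + i * (Q div 4)) * k)) / 4)"
    unfolding twisted_sum_def by (rule sum.cong[OF refl])
  then show ?thesis
    unfolding line_sum_def by (simp add: sum_divide_distrib sum_distrib_left sum.swap[of _ _ D])
qed

lemma norm_twisted_sum_empty:
  "norm (twisted_sum {} j) \<le> (norm (line_sum j) + norm (line_sum (j + Q div 4)) +
     norm (line_sum (j + 2 * (Q div 4))) + norm (line_sum (j + 3 * (Q div 4)))) / 4"
proof -
  have "{0..<4::int} = {0, 1, 2, 3}" by auto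
  then have "(\<Sum>i\<in>{0..<4}. norm (unity_char 4 (- 2 * i) * line_sum (j + i * (Q div 4)))) =
      norm (line_sum j) + norm (line_sum (j + Q div 4)) +
      norm (line_sum (j + 2 * (Q div 4))) + norm (line_sum (j + 3 * (Q div 4)))"
    by (simp add: norm_mult)
  then show ?thesis
    unfolding twisted_sum_empty norm_divide
    using norm_sum[of "\<lambda>i. unity_char 4 (- 2 * i) * line_sum (j + i * (Q div 4))" "{0..<4}"]
    by simp
qed

lemma q_minus_1_dvd_Q: "(int q - 1) dvd Q"
  by (simp add: Q_factor)

lemma four_times_quarter: "4 * (Q div 4) = Q"
  using four_dvd_Q by simp

text \<open>Being trivial on K^* means that \<open>q - 1\<close> divides the frequency. The
  quadratic character always has this property, those of order 4 have it when 4 divides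
  \<open>q + 1\<close>. This is the origin of the factors 2 and 4 in
  \<open>num_trivial\<close>.\<close>

lemma trivial_quarters:
  "(int q - 1) dvd 2 * (Q div 4)"
  "q mod 4 = 3 \<Longrightarrow> (int q - 1) dvd Q div 4"
proof -
  obtain s where "int q + 1 = 2 * s" using odd_q by (metis even_of_nat even_plus_one_iff evenE)
  then have "2 * (Q div 4) = (int q - 1) * s"
    using four_times_quarter unfolding Q_factor by (simp add: algebra_simps)
  then show "(int q - 1) dvd 2 * (Q div 4)" by simp
  assume "q mod 4 = 3"
  then have "4 dvd q + 1" by presburger
  then obtain s where "q + 1 = 4 * s" by (elim dvdE)
  then have "int q + 1 = 4 * int s" by linarith
  then have "Q div 4 = (int q - 1) * int s" unfolding Q_factor by simp
  then show "(int q - 1) dvd Q div 4" by simp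
qed

text \<open>Multiplication by r removes the shift modulo m. In the inductions below the hypothesis
  is about \<open>modulus (insert r C)\<close>, which carries this factor r, and so it survives all
  shifts by characters of order dividing r.\<close>

lemma not_dvd_shift:
  assumes "\<not> m dvd r * j * n" "m dvd r * v"
  shows "\<not> m dvd (j + i * v) * (n :: int)"
proof
  assume "m dvd (j + i * v) * n"
  then have "m dvd r * ((j + i * v) * n) - (r * v) * (i * n)"
    using dvd_diff[OF dvd_mult dvd_mult2[OF assms(2)]] by blast
  then show False using assms(1) by (simp add: algebra_simps)
qed

lemma prime_times_div: "r \<in> odd_primes q \<Longrightarrow> int r * (Q div int r) = Q"
  using prime_dvd_Q by simp

lemma modulus_insert:
  "finite C \<Longrightarrow> r \<notin> C \<Longrightarrow> modulus (insert r C) = int r * modulus C"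
  by (simp add: modulus_def)

lemma not_dvd_modulus:
  assumes "finite C" "C \<subseteq> odd_primes q" "r \<in> odd_primes q" "r \<notin> C" "i \<in> {1..<int r}"
  shows "\<not> int r dvd i * modulus C"
proof
  assume "int r dvd i * modulus C"
  moreover have p: "prime (int r)" using odd_primesD(1)[OF assms(3)] by simp
  moreover have "\<not> int r dvd i" using assms(5) zdvd_not_zless by auto
  moreover have "\<not> int r dvd 4"
  proof
    assume "int r dvd 4"
    then have "int r dvd int 2" using p prime_dvd_mult_iff[of "int r" 2 2] by simp
    then have "r dvd 2" by (simp only: int_dvd_int_iff)
    then show False using odd_primesD[OF assms(3)]
      by (metis primes_dvd_imp_eq two_is_prime_nat dvd_refl)
  qed
  ultimately have "int r dvd (\<Prod>s\<in>C. int s)"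
    unfolding modulus_def by (simp add: prime_dvd_mult_iff)
  then obtain s where "s \<in> C" "int r dvd int s"
    using prime_dvd_prod_iff[OF assms(1) p] by auto
  then show False
    using assms odd_primesD(1) primes_dvd_imp_eq by (metis int_dvd_int_iff subsetD)
qed

text \<open>Here r divides \<open>q - 1\<close>, and \<open>Q div r\<close> equals
  \<open>(q - 1) / r * (q + 1)\<close>. If \<open>q - 1\<close> divided the product, r would divide
  \<open>i * modulus C * (q + 1)\<close>, but r divides none of the three factors.\<close>

lemma shift_nontrivial:
  assumes "finite C" "C \<subseteq> odd_primes q" "r \<in> odd_primes q" "r \<notin> C" "i \<in> {1..<int r}"
    and "\<not> r dvd q + 1" "(int q - 1) dvd j"
  shows "\<not> (int q - 1) dvd (j + i * (Q div r)) * modulus C"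
  using assms(3)
proof (cases rule: prime_dvd_cases)
  case minus
  obtain w where w: "int q - 1 = int r * w" using minus(3) by (elim dvdE)
  have r: "int r > 0" using odd_primesD(1)[OF assms(3)] prime_gt_0_nat by simp
  have "w \<noteq> 0" using w q_gt_1 by auto
  have v: "Q div r = w * (int q + 1)" unfolding Q_factor w using r by simp
  show ?thesis
  proof
    assume "(int q - 1) dvd (j + i * (Q div r)) * modulus C"
    moreover have "(int q - 1) dvd j * modulus C" using assms(7) by simp
    ultimately have "(int q - 1) dvd i * (Q div r) * modulus C"
      by (simp add: distrib_right dvd_add_right_iff)
    then have "w * int r dvd w * ((i * modulus C) * (int q + 1))"
      unfolding v w by (simp add: mult_ac)
    then have "int r dvd (i * modulus C) * (int q + 1)" using \<open>w \<noteq> 0\<close> by simp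
    then show False
      using not_dvd_modulus[OF assms(1-5)] minus(2) odd_primesD(1)[OF assms(3)]
      by (simp add: prime_dvd_mult_iff)
  qed
qed (use assms in auto)

lemma shift_trivial:
  assumes "r \<in> odd_primes q" "r dvd q + 1"
  shows "(int q - 1) dvd Q div r"
proof -
  have "int r dvd int q + 1" using assms(2) by (metis int_dvd_int_iff of_nat_1 of_nat_add)
  then obtain w where w: "int q + 1 = int r * w" by (elim dvdE)
  have r: "int r > 0" using odd_primesD(1)[OF assms(1)] prime_gt_0_nat by simp
  have "Q div r = (int q - 1) * w" unfolding Q_factor w using r by simp
  then show ?thesis by simp
qed

lemma core_density_insert:
  "finite C \<Longrightarrow> r \<notin> C \<Longrightarrow> core_density (insert r C) = (1 - 1 / r) * core_density C"
  by (simp add: core_density_def)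

lemma num_chars_insert:
  "finite C \<Longrightarrow> r \<notin> C \<Longrightarrow> num_chars (insert r C) = 2 * num_chars C"
  by (simp add: num_chars_def)

lemma num_trivial_insert:
  assumes "finite C" "r \<notin> C"
  shows "num_trivial q (insert r C) = (if r dvd q + 1 then 2 else 1) * num_trivial q C"
proof (cases "r dvd q + 1")
  case True
  then have "{s \<in> insert r C. s dvd q + 1} = insert r {s \<in> C. s dvd q + 1}" by auto
  then show ?thesis using assms True by (simp add: num_trivial_def)
next
  case False
  then have "{s \<in> insert r C. s dvd q + 1} = {s \<in> C. s dvd q + 1}" by auto
  then show ?thesis using False by (simp add: num_trivial_def)
qed

lemma mixed_bound_insert:
  assumes "finite C" "r \<notin> C"
  shows "mixed_bound q (insert r C) = mixed_bound q C + char_bound q C r"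
  unfolding mixed_bound_def char_bound_def num_trivial_insert[OF assms] num_chars_insert[OF assms]
  by (simp add: mixed_bound_def algebra_simps)

text \<open>The \<open>r - 1\<close> shifted sums, divided by r, have total weight
  \<open>1 - 1 / r\<close>, the same as the unshifted one. This weight goes into the density and the
  two bounds simply add, which is why every core prime doubles \<open>num_chars\<close>.\<close>

lemma norm_step:
  assumes r: "r \<in> odd_primes q" "r \<notin> C" "finite C"
    and "norm (twisted_sum C j) \<le> core_density C * b"
    and "\<And>i. i \<in> {1..<int r} \<Longrightarrow> norm (twisted_sum C (j + i * (Q div r))) \<le> core_density C * b'"
  shows "norm (twisted_sum (insert r C) j) \<le> core_density (insert r C) * (b + b')"
proof -
  have "r > 0" using odd_primesD(1)[OF r(1)] prime_gt_0_nat by simp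
  then have "cmod (1 - 1 / complex_of_nat r) = 1 - 1 / r"
    using norm_of_real[of "1 - 1 / r", where 'a = complex] by simp
  then have "norm ((1 - 1 / of_nat r) * twisted_sum C j) \<le> (1 - 1 / r) * (core_density C * b)"
    using assms(4) \<open>r > 0\<close> by (simp add: norm_mult mult_left_mono)
  then have "norm (twisted_sum (insert r C) j) \<le> (1 - 1 / r) * (core_density C * b) + (1 - 1 / r) * (core_density C * b')"
    unfolding twisted_sum_insert[OF r(1)]
    using norm_shifts_le[OF r(1) assms(5)]
    by (intro order.trans[OF norm_triangle_ineq4] add_mono) (simp_all add: of_real_diff)
  then show ?thesis unfolding core_density_insert[OF r(3,2)] by (simp only: distrib_left mult.assoc)
qed

text \<open>The third hypothesis says that no core character cancels the j-th character on K^*, so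
  all products occurring in the expansion are nontrivial there and their sums over D have absolute
  value sqrt q.\<close>

lemma norm_twisted_sum_nontrivial:
  assumes "finite C" "C \<subseteq> odd_primes q" "\<not> (int q - 1) dvd j * modulus C"
  shows "norm (twisted_sum C j) \<le> core_density C * (num_chars C * sqrt q)"
  using assms
proof (induction C arbitrary: j rule: finite_induct)
  case empty
  have *: "\<not> (int q - 1) dvd j + i * (Q div 4)" for i
  proof -
    have "\<not> (int q - 1) dvd (j + i * (Q div 4)) * 1"
      using empty by (intro not_dvd_shift[where r = 4]) 
        (auto simp: modulus_def four_times_quarter q_minus_1_dvd_Q mult_ac)
    then show ?thesis by simp
  qed
  show ?case
    using norm_twisted_sum_empty[of j] norm_line_sum_nontrivial[OF *[of 0]]
      norm_line_sum_nontrivial[OF *[of 1]] norm_line_sum_nontrivial[OF *[of 2]]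
      norm_line_sum_nontrivial[OF *[of 3]]
    by (simp add: core_density_def num_chars_def)
next
  case (insert r C)
  have r: "r \<in> odd_primes q" and C: "C \<subseteq> odd_primes q" using insert.prems by auto
  have j: "\<not> (int q - 1) dvd int r * j * modulus C"
    using insert.prems modulus_insert[OF insert.hyps] by (simp add: mult_ac)
  have shift: "norm (twisted_sum C (j + i * (Q div r))) \<le> core_density C * (num_chars C * sqrt q)" for i
    by (rule insert.IH[OF C not_dvd_shift[OF j]])
      (use prime_times_div[OF r] q_minus_1_dvd_Q in auto)
  show ?case
    using norm_step[OF r insert.hyps(2,1) shift[of 0, simplified] shift]
    by (simp add: num_chars_insert[OF insert.hyps] algebra_simps)
qed

text \<open>The j-th character is trivial on K^* but is not a core character. Hence no product is
  principal, and a product is trivial on K^* exactly if its core part is; such terms contribute 1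
  instead of sqrt q.\<close>

lemma norm_twisted_sum_trivial:
  assumes "finite C" "C \<subseteq> odd_primes q" "\<not> Q dvd j * modulus C" "(int q - 1) dvd j"
  shows "norm (twisted_sum C j) \<le> core_density C * mixed_bound q C"
  using assms
proof (induction C arbitrary: j rule: finite_induct)
  case empty
  have *: "\<not> Q dvd j + i * (Q div 4)" for i
  proof -
    have "\<not> Q dvd (j + i * (Q div 4)) * 1"
      using empty by (intro not_dvd_shift[where r = 4]) 
        (auto simp: modulus_def four_times_quarter mult_ac)
    then show ?thesis by simp
  qed
  have 0: "norm (line_sum j) = 1" "norm (line_sum (j + 2 * (Q div 4))) = 1"
    using *[of 0] *[of 2] empty trivial_quarters(1) by (auto intro!: norm_line_sum_trivial)
  have 1: "norm (line_sum (j + Q div 4)) \<le> (if q mod 4 = 3 then 1 else sqrt q)"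
    "norm (line_sum (j + 3 * (Q div 4))) \<le> (if q mod 4 = 3 then 1 else sqrt q)"
    using *[of 1] *[of 3] empty trivial_quarters(2)
    by (auto intro!: norm_line_sum_le eq_refl[OF norm_line_sum_trivial])
  show ?case
    using norm_twisted_sum_empty[of j] 0 1
    by (auto simp: core_density_def num_chars_def mixed_bound_def num_trivial_def split: if_splits)
next
  case (insert r C)
  have r: "r \<in> odd_primes q" and C: "C \<subseteq> odd_primes q" using insert.prems by auto
  have j: "\<not> Q dvd int r * j * modulus C"
    using insert.prems modulus_insert[OF insert.hyps] by (simp add: mult_ac)
  have "\<not> Q dvd (j + i * (Q div r)) * modulus C" for i
    by (rule not_dvd_shift[OF j]) (use prime_times_div[OF r] in auto)
  then have triv: "norm (twisted_sum C (j + i * (Q div r))) \<le> core_density C * mixed_bound q C"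
    if "(int q - 1) dvd j + i * (Q div r)" for i
    using that insert.IH[OF C] by blast
  have "norm (twisted_sum C (j + i * (Q div r))) \<le> core_density C * char_bound q C r"
    if "i \<in> {1..<int r}" for i
  proof (cases "r dvd q + 1")
    case True
    then show ?thesis
      using triv shift_trivial[OF r] insert.prems(3) by (simp add: char_bound_def)
  next
    case False
    then show ?thesis
      using norm_twisted_sum_nontrivial[OF insert.hyps(1) C
        shift_nontrivial[OF insert.hyps(1) C r insert.hyps(2) that False insert.prems(3)]]
      by (simp add: char_bound_def)
  qed
  then show ?case
    using norm_step[OF r insert.hyps(2,1) triv[of 0, simplified, OF insert.prems(3)]]
    by (simp add: mixed_bound_insert[OF insert.hyps])
qed

lemma norm_twisted_sum_shift:
  assumes "finite C" "C \<subseteq> odd_primes q" "r \<in> odd_primes q" "r \<notin> C" "i \<in> {1..<int r}"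
  shows "norm (twisted_sum C (i * (Q div r))) \<le> core_density C * char_bound q C r"
proof (cases "r dvd q + 1")
  case True
  have "\<not> Q dvd i * (Q div r) * modulus C"
  proof
    assume "Q dvd i * (Q div r) * modulus C"
    then have "(Q div r) * int r dvd (Q div r) * (i * modulus C)"
      using prime_times_div[OF assms(3)] by (simp add: mult_ac)
    moreover have "Q div r \<noteq> 0" using prime_times_div[OF assms(3)] Q_pos by auto
    ultimately show False using not_dvd_modulus[OF assms] by simp
  qed
  then show ?thesis
    using norm_twisted_sum_trivial[OF assms(1,2)] shift_trivial[OF assms(3) True] True
    by (simp add: char_bound_def)
next
  case False
  then show ?thesis
    using norm_twisted_sum_nontrivial[OF assms(1,2)] shift_nontrivial[OF assms False, of 0]
    by (simp add: char_bound_def)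
qed

text \<open>The main term is the contribution of the principal character. It is one of the
  characters counted with weight 1 in \<open>mixed_bound q C\<close> and causes no error, hence the
  \<open>- 1\<close>.\<close>

lemma twisted_sum_0_approx:
  assumes "finite C" "C \<subseteq> odd_primes q"
  shows "norm (twisted_sum C 0 - core_density C * q) \<le> core_density C * (mixed_bound q C - 1)"
  using assms
proof (induction C rule: finite_induct)
  case empty
  have *: "\<not> Q dvd i * (Q div 4)" if "i \<in> {1..<4}" for i
  proof
    assume "Q dvd i * (Q div 4)"
    then have "(Q div 4) * 4 dvd (Q div 4) * i" using four_times_quarter by (simp add: mult_ac)
    moreover have "Q div 4 \<noteq> 0" using four_times_quarter Q_pos by auto
    ultimately show False using that zdvd_not_zless by auto
  qed
  have 0: "norm (line_sum (2 * (Q div 4))) = 1"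
    using *[of 2] trivial_quarters(1) by (auto intro!: norm_line_sum_trivial)
  have 1: "norm (line_sum (Q div 4)) \<le> (if q mod 4 = 3 then 1 else sqrt q)"
    "norm (line_sum (3 * (Q div 4))) \<le> (if q mod 4 = 3 then 1 else sqrt q)"
    using *[of 1] *[of 3] trivial_quarters(2)
    by (auto intro!: norm_line_sum_le eq_refl[OF norm_line_sum_trivial])
  have split: "{0..<4::int} = insert 0 {1, 2, 3}" by auto
  have "twisted_sum {} 0 - core_density {} * q =
      (\<Sum>i\<in>{1, 2, 3}. unity_char 4 (- 2 * i) * line_sum (i * (Q div 4))) / 4"
    unfolding twisted_sum_empty split by (simp add: line_sum_0 core_density_def add_divide_distrib)
  also have "norm \<dots> \<le> (norm (line_sum (Q div 4)) + norm (line_sum (2 * (Q div 4))) +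
      norm (line_sum (3 * (Q div 4)))) / 4"
    using norm_sum[of "\<lambda>i. unity_char 4 (- 2 * i) * line_sum (i * (Q div 4))" "{1, 2, 3}"]
    by (simp add: norm_divide norm_mult)
  finally show ?case
    using 0 1
    by (auto simp: core_density_def num_chars_def mixed_bound_def num_trivial_def split: if_splits)
next
  case (insert r C)
  have r: "r \<in> odd_primes q" and C: "C \<subseteq> odd_primes q" using insert.prems by auto
  have "r > 0" using odd_primesD(1)[OF r] prime_gt_0_nat by simp
  then have c: "cmod (1 - 1 / complex_of_nat r) = 1 - 1 / r"
    using norm_of_real[of "1 - 1 / r", where 'a = complex] by simp
  have "twisted_sum (insert r C) 0 - core_density (insert r C) * q =
      (1 - 1 / r) * (twisted_sum C 0 - core_density C * q)
      - (\<Sum>i\<in>{1..<int r}. twisted_sum C (0 + i * (Q div r))) / r"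
    unfolding twisted_sum_insert[OF r] core_density_insert[OF insert.hyps]
    by (simp add: algebra_simps)
  also have "norm \<dots> \<le> (1 - 1 / r) * (core_density C * (mixed_bound q C - 1)) +
      (1 - 1 / r) * (core_density C * char_bound q C r)"
  proof (intro order.trans[OF norm_triangle_ineq4] add_mono norm_shifts_le r)
    show "norm (complex_of_real (1 - 1 / r) * (twisted_sum C 0 - core_density C * q)) \<le>
        (1 - 1 / r) * (core_density C * (mixed_bound q C - 1))"
      using insert.IH[OF C] \<open>r > 0\<close> c by (simp add: norm_mult mult_left_mono)
  qed (use norm_twisted_sum_shift[OF insert.hyps(1) C r insert.hyps(2)] in simp)
  finally show ?case
    unfolding core_density_insert[OF insert.hyps] mixed_bound_insert[OF insert.hyps]
    by (simp add: algebra_simps)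
qed

text \<open>If nothing survives, each of the N exponents passing the core is divisible by a sieved
  prime r, and r divides at most N/r plus an error of them. Summing over r gives
  \<open>N * d\<close> below the total error, while the criterion together with the lower bound for
  N says the opposite.\<close>

lemma exists_in_D_if_sieve_criterion:
  assumes "sieve_criterion q C"
  shows "\<exists>k\<in>D. k mod 4 = 2 \<and> (\<forall>r\<in>odd_primes q. \<not> int r dvd k)"
proof (rule ccontr)
  assume none: "\<not> ?thesis"
  define S where "S = odd_primes q - C"
  define d where "d = 1 - (\<Sum>r\<in>S. 1 / real r)"
  have C: "C \<subseteq> odd_primes q" and d: "d \<ge> 0"
    and crit: "(\<Sum>r\<in>S. (1 - 1 / r) * char_bound q C r) < d * (q + 1 - mixed_bound q C)"
    using assms by (simp_all add: sieve_criterion_def Let_def S_def d_def add.commute)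
  have fin: "finite C" "finite S"
    using C finite_odd_primes[OF q_gt_1] finite_subset by (auto simp: S_def)
  define good where "good = {k \<in> D. core C k = 1}"
  define N where "N = real (card good)"
  define M where "M = (\<lambda>r::nat. real (card {k \<in> good. int r dvd k}))"
  have finite_good: "finite good" using finite_D by (simp add: good_def)
  have core_01: "core C k = 0 \<or> core C k = 1" for k by (simp add: core_def)
  have "good \<subseteq> (\<Union>r\<in>S. {k \<in> good. int r dvd k})"
    using none by (fastforce simp: good_def core_def S_def split: if_splits)
  then have "card good \<le> card (\<Union>r\<in>S. {k \<in> good. int r dvd k})"
    using finite_good fin by (intro card_mono) auto
  also have "\<dots> \<le> (\<Sum>r\<in>S. card {k \<in> good. int r dvd k})"
    using fin by (intro card_UN_le) auto
  finally have union: "N \<le> (\<Sum>r\<in>S. M r)"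
    unfolding N_def M_def by (simp only: of_nat_le_iff flip: of_nat_sum)
  have card_eq: "(\<Sum>k\<in>D. if k \<in> G then 1 else 0) = complex_of_real (card G)" if "G \<subseteq> D" for G
  proof -
    have "(\<Sum>k\<in>D. if k \<in> G then 1 else 0) = (\<Sum>k\<in>G. 1 :: complex)"
      using finite_D that by (intro sum.mono_neutral_cong_right) auto
    then show ?thesis by simp
  qed
  have tN: "twisted_sum C 0 = N"
  proof -
    have "twisted_sum C 0 = (\<Sum>k\<in>D. if k \<in> good then 1 else 0)"
      unfolding twisted_sum_def good_def using core_01 by (intro sum.cong) auto
    also have "\<dots> = N" unfolding N_def by (rule card_eq) (auto simp: good_def)
    finally show ?thesis .
  qed
  have tM: "M r \<le> N / r + (1 - 1 / r) * (core_density C * char_bound q C r)" if "r \<in> S" for r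
  proof -
    have r: "r \<in> odd_primes q" "r \<notin> C" using that by (auto simp: S_def)
    have r0: "int r > 0" using odd_primesD(1)[OF r(1)] prime_gt_0_nat by simp
    have split: "{0..<int r} = insert 0 {1..<int r}" using r0 by auto
    have "complex_of_real (M r) = (\<Sum>k\<in>D. if k \<in> {k \<in> good. int r dvd k} then 1 else 0)"
      unfolding M_def by (rule card_eq[symmetric]) (auto simp: good_def)
    also have "\<dots> = (\<Sum>k\<in>D. if int r dvd k then core C k * unity_char Q (0 * k) else 0)"
      unfolding good_def using core_01 by (intro sum.cong) auto
    also have "\<dots> = N / r + (\<Sum>i\<in>{1..<int r}. twisted_sum C (0 + i * (Q div r))) / r"
      unfolding twisted_sum_multiples[OF r(1)] split using tN by (simp add: add_divide_distrib)
    finally have "(\<Sum>i\<in>{1..<int r}. twisted_sum C (0 + i * (Q div r))) / r = complex_of_real (M r - N / r)"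
      by simp
    moreover have "norm ((\<Sum>i\<in>{1..<int r}. twisted_sum C (0 + i * (Q div r))) / r) \<le>
        (1 - 1 / r) * (core_density C * char_bound q C r)"
      using norm_twisted_sum_shift[OF fin(1) C r] by (intro norm_shifts_le r) simp
    ultimately have "\<bar>M r - N / r\<bar> \<le> (1 - 1 / r) * (core_density C * char_bound q C r)"
      by (simp only: norm_of_real)
    then show ?thesis by linarith
  qed
  have "N \<le> (\<Sum>r\<in>S. N / r + (1 - 1 / r) * (core_density C * char_bound q C r))"
    using union tM by (meson order.trans sum_mono)
  also have "\<dots> = N * (1 - d) + core_density C * (\<Sum>r\<in>S. (1 - 1 / r) * char_bound q C r)"
    by (simp add: d_def sum.distrib sum_distrib_left mult_ac)
  finally have "N * d \<le> core_density C * (\<Sum>r\<in>S. (1 - 1 / r) * char_bound q C r)"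
    by (simp add: algebra_simps)
  also have "\<dots> < core_density C * (d * (q + 1 - mixed_bound q C))"
  proof (intro mult_strict_left_mono crit)
    have "1 - 1 / real r > 0" if "r \<in> C" for r
    proof -
      have "r > 1" using prime_gt_1_nat[OF odd_primesD(1)] that C by blast
      then show ?thesis by simp
    qed
    then show "core_density C > 0" unfolding core_density_def by (auto intro!: prod_pos)
  qed
  also have "\<dots> \<le> N * d"
  proof -
    have "norm (complex_of_real (N - core_density C * q)) \<le> core_density C * (mixed_bound q C - 1)"
      using twisted_sum_0_approx[OF fin(1) C] tN by simp
    then have "core_density C * (q + 1 - mixed_bound q C) \<le> N"
      unfolding norm_of_real by (simp add: algebra_simps)
    from mult_right_mono[OF this d] show ?thesis by (simp add: mult_ac)
  qed
  finally show False by simp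
qed

end

section \<open>Large fields\<close>

text \<open>After cancelling the common part, the minimum of f over \<open>T - S\<close> separates
  the two sides. With T the smallest primes it replaces the unknown prime factors by the worst
  case.\<close>

lemma sum_exchange_le:
  fixes f :: "'a \<Rightarrow> real"
  assumes "finite S" "finite T" "card S \<le> card T"
    and "\<And>s t. s \<in> S - T \<Longrightarrow> t \<in> T - S \<Longrightarrow> f s \<le> f t" "\<And>t. t \<in> T - S \<Longrightarrow> 0 \<le> f t"
  shows "sum f S \<le> sum f T"
proof -
  have card_le: "card (S - T) \<le> card (T - S)"
    using assms(1-3) card_Diff_subset_Int[of S T] card_Diff_subset_Int[of T S]
    by (simp add: Int_commute)
  have "sum f (S - T) \<le> sum f (T - S)"
  proof (cases "T - S = {}")
    case True
    then have "S - T = {}" using card_le assms(1) by (metis card.empty card_0_eq finite_Diff le_zero_eq)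
    then show ?thesis using True by simp
  next
    case False
    define m where "m = Min (f ` (T - S))"
    have fin: "finite (f ` (T - S))" "f ` (T - S) \<noteq> {}" using False assms(2) by auto
    have m: "m \<in> f ` (T - S)" unfolding m_def using Min_in[OF fin] .
    have "sum f (S - T) \<le> real (card (S - T)) * m"
      using m assms(4) by (intro sum_bounded_above) auto
    also have "\<dots> \<le> real (card (T - S)) * m"
      using card_le m assms(5) by (intro mult_right_mono) auto
    also have "\<dots> \<le> sum f (T - S)"
      using fin by (intro sum_bounded_below) (auto simp: m_def)
    finally show ?thesis .
  qed
  moreover have "sum f S = sum f (S \<inter> T) + sum f (S - T)"
    using assms(1) by (metis Diff_Diff_Int sum.Int_Diff)
  moreover have "sum f T = sum f (S \<inter> T) + sum f (T - S)"
    using assms(2) by (metis Int_commute sum.Int_Diff)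
  ultimately show ?thesis by simp
qed

text \<open>This is the previous lemma for logarithms. Dividing by c allows S to be larger than T:
  its surplus elements are at least c and contribute factors of at least 1.\<close>

lemma prod_exchange_le:
  fixes S T :: "nat set"
  assumes "finite S" "finite T" "card T \<le> card S" "c > 0" "0 \<notin> S \<union> T"
    and "\<And>s t. s \<in> S - T \<Longrightarrow> t \<in> T - S \<Longrightarrow> t \<le> s" "\<And>s. s \<in> S - T \<Longrightarrow> c \<le> real s"
  shows "(\<Prod>t\<in>T. real t / c) \<le> (\<Prod>s\<in>S. real s / c)"
proof -
  have pos: "s \<in> S \<union> T \<Longrightarrow> real s / c > 0" for s
    using assms(4,5) by (metis divide_pos_pos gr0I of_nat_0_less_iff)
  have "(\<Sum>t\<in>T. ln (real t / c)) \<le> (\<Sum>s\<in>S. ln (real s / c))"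
  proof (rule sum_exchange_le[OF assms(2,1,3)])
    fix s t assume st: "s \<in> T - S" "t \<in> S - T"
    then have "real s / c \<le> real t / c" using assms(4,6) by (simp add: divide_right_mono)
    then show "ln (real s / c) \<le> ln (real t / c)" using pos st by (subst ln_le_cancel_iff) auto
  qed (use assms(4,7) in \<open>simp add: ln_ge_zero\<close>)
  then have "exp (\<Sum>t\<in>T. ln (real t / c)) \<le> exp (\<Sum>s\<in>S. ln (real s / c))" by simp
  then show ?thesis using assms(1,2) pos by (simp add: exp_sum)
qed

lemma prod_primes_dvd:
  fixes n :: nat
  assumes "finite P" "\<And>p. p \<in> P \<Longrightarrow> prime p \<and> p dvd n"
  shows "\<Prod>P dvd n"
  using assms
proof (induction P rule: finite_induct)
  case (insert p P)
  have "coprime p (\<Prod>P)"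
    using insert by (intro prod_coprime_right) (metis insertCI primes_coprime)
  then show ?case using insert by (simp add: divides_mult)
qed simp

lemma eight_prod_odd_primes_less:
  assumes "odd q" "q > 1" "P \<subseteq> odd_primes q"
  shows "8 * \<Prod>P < q\<^sup>2"
proof -
  have fin: "finite P" using finite_odd_primes[OF assms(2)] assms(3) finite_subset by blast
  obtain k where k: "q = 2 * k + 1" using assms(1) by (elim oddE)
  have "8 dvd q\<^sup>2 - 1"
  proof -
    have "2 dvd k * (k + 1)" by simp
    then obtain l where "k * (k + 1) = 2 * l" by (elim dvdE)
    then have "q\<^sup>2 - 1 = 8 * l" unfolding k by (simp add: power2_eq_square algebra_simps)
    then show ?thesis by simp
  qed
  moreover have "\<Prod>P dvd q\<^sup>2 - 1"
    using assms(3) odd_primesD by (intro prod_primes_dvd fin) auto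
  moreover have "coprime 8 (\<Prod>P)"
  proof (rule prod_coprime_right)
    fix p assume "p \<in> P"
    then have "odd p" using assms(3) odd_primesD by blast
    then have "coprime (2 ^ 3) p" by (metis coprime_left_2_iff_odd coprime_power_left_iff)
    then show "coprime 8 p" by simp
  qed
  ultimately have "8 * \<Prod>P dvd q\<^sup>2 - 1" by (simp add: divides_mult)
  moreover have "q\<^sup>2 - 1 > 0" using assms(2) by (simp add: power2_eq_square one_less_mult)
  ultimately have "8 * \<Prod>P \<le> q\<^sup>2 - 1" by (simp add: dvd_imp_le)
  then show ?thesis using \<open>q\<^sup>2 - 1 > 0\<close> by linarith
qed

text \<open>With sqrt q as the bound for every character, the inequality reads (|S| - 1 + d) * t *
  sqrt q < d * (q - t * sqrt q) with t = \<open>num_chars C\<close>; dividing by sqrt q gives the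
  hypothesis.\<close>

lemma sieve_criterionI_simple:
  fixes q :: nat and C :: "nat set"
  defines "S \<equiv> odd_primes q - C"
  defines "d \<equiv> 1 - (\<Sum>r\<in>S. 1 / real r)"
  assumes "q > 1" "C \<subseteq> odd_primes q" "d \<ge> 0"
    and ineq: "num_chars C * (real (card S) - 1 + 2 * d) < d * sqrt q"
  shows "sieve_criterion q C"
proof -
  have fin: "finite C" using finite_odd_primes[OF assms(3)] assms(4) finite_subset by blast
  note mb = mixed_bound_le[OF fin, of q]
  have "(\<Sum>r\<in>S. (1 - 1 / r) * char_bound q C r) \<le> (\<Sum>r\<in>S. (1 - 1 / r) * (num_chars C * sqrt q))"
  proof (intro sum_mono mult_left_mono)
    fix r assume "r \<in> S"
    then have "r > 0" using odd_primesD prime_gt_0_nat by (auto simp: S_def)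
    then show "0 \<le> 1 - 1 / real r" by simp
  qed (use mb assms(3) in \<open>auto simp: char_bound_def\<close>)
  also have "\<dots> = (real (card S) - 1 + d) * (num_chars C * sqrt q)"
    by (simp add: sum_subtractf d_def flip: sum_distrib_right)
  also have "\<dots> = num_chars C * (real (card S) - 1 + 2 * d) * sqrt q - d * (num_chars C * sqrt q)"
    by (simp add: algebra_simps)
  also have "\<dots> < d * sqrt q * sqrt q - d * (num_chars C * sqrt q)"
    using ineq assms(3) by simp
  also have "\<dots> = d * (q - num_chars C * sqrt q)" by (simp add: algebra_simps)
  also have "\<dots> \<le> d * (q + 1 - mixed_bound q C)"
    using mb assms(3,5) by (intro mult_left_mono) auto
  finally show ?thesis
    using assms(4,5) unfolding sieve_criterion_def Let_def S_def d_def by (simp add: add.commute)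
qed

lemma prime_ge_5_less_61:
  assumes "prime (r::nat)" "5 \<le> r" "r < 61"
  shows "r \<in> {5, 7, 11, 13, 17, 19, 23, 29, 31, 37, 41, 43, 47, 53, 59}"
proof -
  have "\<not> 2 dvd r" "\<not> 3 dvd r" "\<not> 5 dvd r \<or> r = 5" "\<not> 7 dvd r \<or> r = 7"
    using assms primes_dvd_imp_eq[of 2 r] primes_dvd_imp_eq[of 3 r] primes_dvd_imp_eq[of 5 r]
      primes_dvd_imp_eq[of 7 r] by auto
  moreover have "[5..<61] = [5,6,7,8,9,10,11,12,13,14,15,16,17,18,19,20,21,22,23,24,25,26,27,28,29,30,31,32,
     33,34,35,36,37,38,39,40,41,42,43,44,45,46,47,48,49,50,51,52,53,54,55,56,57,58,59,60]"
    by (simp add: upt_rec)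
  then have "r \<in> set [5,6,7,8,9,10,11,12,13,14,15,16,17,18,19,20,21,22,23,24,25,26,27,28,29,30,31,32,
     33,34,35,36,37,38,39,40,41,42,43,44,45,46,47,48,49,50,51,52,53,54,55,56,57,58,59,60]"
    using assms(2,3) by (metis atLeastLessThan_iff set_upt)
  ultimately show ?thesis by auto
qed

lemma odd_primes_eq_3_or_ge_5:
  assumes "r \<in> odd_primes q"
  shows "r = 3 \<or> 5 \<le> r"
proof -
  have "r \<noteq> 2" "r \<noteq> 4" "2 \<le> r"
    using odd_primesD[OF assms] prime_ge_2_nat by auto
  then show ?thesis by linarith
qed

text \<open>T is a list of primes that bounds the unknown prime factors from below. With at most 3
  in the core, \<open>num_chars\<close> is at most 8; the constant 16 is twice this, from the term
  \<open>2 * d\<close> of the simple criterion.\<close>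

lemma sieve_criterion_few:
  fixes q :: nat and T :: "nat set"
  defines "S \<equiv> {r \<in> odd_primes q. 5 \<le> r}"
  assumes "q > 1" "finite T" "card S \<le> card T"
    and T: "\<And>s t. s \<in> S - T \<Longrightarrow> t \<in> T \<Longrightarrow> t \<le> s"
    and w: "w\<^sup>2 \<le> real q" "w \<ge> 16" "8 * (real (card T) - 1) < (1 - (\<Sum>t\<in>T. 1 / real t)) * (w - 16)"
    and T0: "0 \<notin> T" "T \<noteq> {}"
  shows "sieve_criterion q (odd_primes q \<inter> {3})"
proof -
  let ?C = "odd_primes q \<inter> {3}"
  have fin: "finite (odd_primes q)" using assms by (intro finite_odd_primes)
  have S: "odd_primes q - ?C = S"
    using odd_primes_eq_3_or_ge_5 unfolding S_def by force
  define d where "d = 1 - (\<Sum>r\<in>S. 1 / real r)"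
  have "(\<Sum>r\<in>S. 1 / real r) \<le> (\<Sum>t\<in>T. 1 / real t)"
  proof (rule sum_exchange_le)
    show "finite S" unfolding S_def using fin by simp
    fix s t assume st: "s \<in> S - T" "t \<in> T - S"
    have "t \<le> s" using T st by blast
    moreover have "t \<noteq> 0" using T0(1) st(2) by (metis DiffD1)
    ultimately show "1 / real s \<le> 1 / real t" by (simp add: frac_le)
  qed (simp_all add: assms(3,4))
  then have d: "1 - (\<Sum>t\<in>T. 1 / real t) \<le> d" by (simp add: d_def)
  have sT: "real (card S) - 1 \<le> real (card T) - 1" using assms(4) by simp
  have "card T \<ge> 1" using T0 assms(3) by (simp add: Suc_leI card_gt_0_iff)
  then have "0 \<le> 8 * (real (card T) - 1)" by simp
  then have d0: "0 < 1 - (\<Sum>t\<in>T. 1 / real t)"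
    using w(2,3) mult_nonpos_nonneg[of "1 - (\<Sum>t\<in>T. 1 / real t)" "w - 16"] by linarith
  have sq: "w \<le> sqrt q" using w(1) by (rule real_le_rsqrt)
  have "card ?C \<le> 1" by (rule order.trans[OF card_mono[of "{3}"]]) auto
  then have "(2::real) ^ card ?C \<le> 2 ^ 1" by (intro power_increasing) auto
  then have t: "num_chars ?C \<le> 8" "num_chars ?C \<ge> 0" unfolding num_chars_def by simp_all
  have "num_chars ?C * (real (card S) - 1) \<le> num_chars ?C * (real (card T) - 1)"
    using sT t by (intro mult_left_mono) auto
  also have "\<dots> \<le> 8 * (real (card T) - 1)" using t \<open>card T \<ge> 1\<close> by (intro mult_right_mono) auto
  also have "\<dots> < (1 - (\<Sum>t\<in>T. 1 / real t)) * (w - 16)" by (rule w)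
  also have "\<dots> \<le> d * (w - 16)" using d w by (intro mult_right_mono) auto
  also have "\<dots> \<le> d * (sqrt q - 2 * num_chars ?C)" using d d0 sq t by (intro mult_left_mono) auto
  finally have "num_chars ?C * (real (card S) - 1 + 2 * d) < d * sqrt q" by (simp add: algebra_simps)
  then show ?thesis
    using d d0 assms(2) by (intro sieve_criterionI_simple) (simp_all add: S flip: d_def)
qed

lemma sieve_criterion_large:
  assumes "odd q" "q \<ge> 26000"
  shows "\<exists>C. sieve_criterion q C"
proof -
  define S where "S = {r \<in> odd_primes q. 5 \<le> r}"
  have fin: "finite (odd_primes q)" "finite S"
    using assms finite_odd_primes[of q] by (auto simp: S_def)
  have prime_S: "prime s" "5 \<le> s" "s \<in> odd_primes q" if "s \<in> S" for s
    using that odd_primesD by (auto simp: S_def)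
  have few: ?thesis
    if T: "card S \<le> card T" "\<And>r. prime r \<Longrightarrow> 5 \<le> r \<Longrightarrow> r \<le> Max T \<Longrightarrow> r \<in> T"
      "finite T" "T \<noteq> {}" "0 \<notin> T"
      and w: "w\<^sup>2 \<le> real q" "w \<ge> 16"
        "8 * (real (card T) - 1) < (1 - (\<Sum>t\<in>T. 1 / real t)) * (w - 16)" for T w
  proof -
    have "sieve_criterion q (odd_primes q \<inter> {3})"
    proof (rule sieve_criterion_few[where q = q and T = T and w = w, folded S_def])
      fix s t assume st: "s \<in> S - T" "t \<in> T"
      have "\<not> s \<le> Max T" using st T(2) prime_S by blast
      moreover have "t \<le> Max T" using st T(3) by simp
      ultimately show "t \<le> s" by simp
    qed (use assms(2) T w in simp_all)
    then show ?thesis ..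
  qed
  have many: "8 * real (\<Prod>T) < (real q)\<^sup>2"
    if "card T \<le> card S" "\<And>r. prime r \<Longrightarrow> 5 \<le> r \<Longrightarrow> r \<le> Max T \<Longrightarrow> r \<in> T" "finite T" "0 \<notin> T" for T
  proof -
    have "(\<Prod>t\<in>T. real t / 1) \<le> (\<Prod>s\<in>S. real s / 1)"
    proof (rule prod_exchange_le)
      fix s t assume "s \<in> S - T" "t \<in> T - S"
      then show "t \<le> s" 
        using that(2)[of s] prime_S[of s] Max_ge[OF that(3), of t] by (meson DiffE nle_le order.trans)
    next
      show "0 \<notin> S \<union> T" using that(4) prime_S(2)[of 0] by auto
    next
      fix s assume "s \<in> S - T"
      then show "1 \<le> real s" using prime_S(2)[of s] by simp
    qed (use that fin in auto)
    then have "8 * real (\<Prod>T) \<le> 8 * real (\<Prod>S)" by simp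
    also have "\<dots> < real (q\<^sup>2)"
    proof -
      have "8 * \<Prod>S < q\<^sup>2"
        using assms by (intro eight_prod_odd_primes_less) (auto simp: S_def)
      then have "real (8 * \<Prod>S) < real (q\<^sup>2)" by (simp only: of_nat_less_iff)
      then show ?thesis by simp
    qed
    finally show ?thesis by simp
  qed
  consider "card S \<le> 7" | "card S = 8" | "9 \<le> card S" "card S \<le> 14" | "15 \<le> card S" by linarith
  then show ?thesis
  proof cases
    case 1
    \<comment> \<open>The inequality for these seven primes needs w of about 160, and
      \<open>161^2 = 25921\<close> fits just below the threshold 26000.\<close>
    let ?T = "{5, 7, 11, 13, 17, 19, 23} :: nat set"
    show ?thesis
    proof (rule few[of ?T 161])
      fix r :: nat assume "prime r" "5 \<le> r" "r \<le> Max ?T"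
      then show "r \<in> ?T" using prime_ge_5_less_61[of r] by auto
    qed (use 1 assms in auto)
  next
    case 2
    \<comment> \<open>Eight times this product lies just above \<open>304^4\<close>, so eight prime
      factors force sqrt q > 304. About 203 would do.\<close>
    let ?T = "{5, 7, 11, 13, 17, 19, 23, 29} :: nat set"
    have T: "r \<in> ?T" if "prime r" "5 \<le> r" "r \<le> Max ?T" for r using prime_ge_5_less_61[of r] that by auto
    have "8 * real (\<Prod>?T) < (real q)\<^sup>2" by (rule many) (use 2 T in auto)
    then have "304 ^ 4 < (real q)\<^sup>2" by simp
    then have "(304\<^sup>2)\<^sup>2 < (real q)\<^sup>2" by simp
    then have "304\<^sup>2 < real q" by (rule power_less_imp_less_base) simp
    then show ?thesis by (intro few[of ?T 304]) (use 2 T in auto)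
  next
    case 3
    \<comment> \<open>Nine prime factors force sqrt q > 719. This suffices for up to 14 primes,
      whereas 15 would require about 840.\<close>
    let ?T = "{5, 7, 11, 13, 17, 19, 23, 29, 31} :: nat set"
    let ?T' = "{5, 7, 11, 13, 17, 19, 23, 29, 31, 37, 41, 43, 47, 53} :: nat set"
    have T: "r \<in> ?T" if "prime r" "5 \<le> r" "r \<le> Max ?T" for r using prime_ge_5_less_61[of r] that by auto
    have T': "r \<in> ?T'" if "prime r" "5 \<le> r" "r \<le> Max ?T'" for r using prime_ge_5_less_61[of r] that by auto
    have "8 * real (\<Prod>?T) < (real q)\<^sup>2" by (rule many) (use 3 T in auto)
    then have "(719\<^sup>2)\<^sup>2 < (real q)\<^sup>2" by simp
    then have "719\<^sup>2 < real q" by (rule power_less_imp_less_base) simp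
    then show ?thesis by (intro few[of ?T' 719]) (use 3 T' in auto)
  next
    case 4
    \<comment> \<open>With this many primes their product outgrows the powers of 16, so all of them
      go into the core and nothing is sieved. It remains to show that the fourth power of
      \<open>num_chars\<close>, which is \<open>256 * 16^n\<close>, is less than
      \<open>q^2\<close>.\<close>
    let ?T = "{5, 7, 11, 13, 17, 19, 23, 29, 31, 37, 41, 43, 47, 53, 59} :: nat set"
    have T: "r \<in> ?T" if "prime r" "5 \<le> r" "r < 61" for r using prime_ge_5_less_61[OF that] .
    \<comment> \<open>171 is the least integer with \<open>3 * 171 >= 32 * 16\<close>: if 3 divides
      \<open>q^2 - 1\<close>, the extra prime brings a factor of only 3 against 16. The 32 is 256 /
      8.\<close>
    have "171 \<le> (\<Prod>t\<in>?T. real t / 16)" by simp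
    also have "\<dots> \<le> (\<Prod>s\<in>S. real s / 16)"
    proof (rule prod_exchange_le)
      fix s assume "s \<in> S - ?T"
      then have "s \<ge> 61" using prime_S[of s] T[of s] by (meson DiffE not_less)
      then show "16 \<le> real s" "t \<in> ?T - S \<Longrightarrow> t \<le> s" for t by auto
    next
      show "0 \<notin> S \<union> ?T" using prime_S(2)[of 0] by auto
    qed (use 4 fin in auto)
    also have "\<dots> = real (\<Prod>S) / 16 ^ card S" by (simp add: prod_dividef)
    finally have S: "171 * 16 ^ card S \<le> real (\<Prod>S)" by (simp add: field_simps)
    have "32 * 16 ^ card (odd_primes q) \<le> real (\<Prod>(odd_primes q))"
    proof (cases "3 \<in> odd_primes q")
      case True
      then have "odd_primes q = insert 3 S"
        unfolding S_def using odd_primes_eq_3_or_ge_5 by blast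
      moreover have "3 \<notin> S" by (simp add: S_def)
      moreover have "512 * 16 ^ card S \<le> 3 * real (\<Prod>S)"
        using S zero_le_power[of "16 :: real" "card S"] by linarith
      ultimately show ?thesis using fin by simp
    next
      case False
      then have "odd_primes q = S" unfolding S_def using odd_primes_eq_3_or_ge_5 by blast
      moreover have "32 * 16 ^ card S \<le> real (\<Prod>S)"
        using S zero_le_power[of "16 :: real" "card S"] by linarith
      ultimately show ?thesis by simp
    qed
    moreover have "8 * real (\<Prod>(odd_primes q)) < (real q)\<^sup>2"
    proof -
      have "8 * \<Prod>(odd_primes q) < q\<^sup>2"
        using assms by (intro eight_prod_odd_primes_less) auto
      then have "real (8 * \<Prod>(odd_primes q)) < real (q\<^sup>2)" by (simp only: of_nat_less_iff)
      then show ?thesis by simp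
    qed
    ultimately have "256 * 16 ^ card (odd_primes q) < (real q)\<^sup>2" by linarith
    also have "256 * 16 ^ card (odd_primes q) = ((num_chars (odd_primes q))\<^sup>2)\<^sup>2"
    proof -
      have "(16::real) ^ n = ((2 ^ n)\<^sup>2)\<^sup>2" for n
        by (simp only: power_mult[symmetric] power_commutes mult.commute[of n]) (simp add: power_mult)
      then show ?thesis by (simp add: num_chars_def power_mult_distrib)
    qed
    finally have "(num_chars (odd_primes q))\<^sup>2 < real q" by (rule power_less_imp_less_base) simp
    then have "num_chars (odd_primes q) < sqrt q" by (rule real_less_rsqrt)
    then show ?thesis using assms
      by (intro exI[of _ "odd_primes q"] sieve_criterionI_simple) auto
  qed
qed

section \<open>Small fields\<close>

text \<open>
  An entry \<open>(p, h, l, r)\<close> holds the weights of the prime \<open>p\<close> and the residue \<open>r\<close> of \<open>q\<close> modulo \<open>p\<close>;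
  the residues are updated from \<open>q\<close> to \<open>q + 2\<close>, which avoids division.
\<close>
type_synonym residue_entry = "int \<times> int \<times> int \<times> int"

text \<open>
  The checker works with integers in units of $1/10000$, rounded in the safe direction: \<open>d\<close> is a
  lower bound for $1 - \sum 1/r$ over the sieving primes, \<open>x\<close> and \<open>y\<close> are upper bounds for
  $\sum (1 - 1/r)$ over those dividing $q - 1$ and $q + 1$; \<open>u\<close> and \<open>t\<close> stand for \<open>num_trivial\<close> and
  \<open>num_chars\<close>. Intermediate values are passed as arguments because a \<open>let\<close> would be expanded before
  its value is computed.
\<close>
definition accept :: "int \<Rightarrow> int \<Rightarrow> int \<Rightarrow> int \<Rightarrow> bool" where
  "accept q d f h \<longleftrightarrow> 0 \<le> d \<and> 0 < f \<and> h * h * q < f * f"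

definition decide :: "int \<Rightarrow> int \<Rightarrow> int \<Rightarrow> int \<Rightarrow> int \<Rightarrow> int \<Rightarrow> bool" where
  "decide q u t d x y = accept q d (d * (q - u + 1) - u * y) (d * (t - u) + x * t + y * (t - u))"

text \<open>Each prime from 29 on is charged with the worst values: 345 is 10000/29 rounded up, and
  10000 stands for \<open>1 - 1/r < 1\<close>.\<close>

definition add_big :: "int \<Rightarrow> int \<Rightarrow> int \<Rightarrow> int \<Rightarrow> int \<Rightarrow> int \<Rightarrow> int \<Rightarrow> int \<Rightarrow> bool" where
  "add_big q u t d x y a b = decide q u t (d - 345 * (a + b)) (x + 10000 * a) (y + 10000 * b)"

text \<open>
  Bounds the number of prime factors $\ge 29$ of an even $n < 2 \cdot 29^3$ that is divisible by the odd
  squarefree number \<open>P\<close>, which has only smaller prime factors.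
\<close>
definition big_bound :: "int \<Rightarrow> int \<Rightarrow> int" where
  "big_bound n P = (if n < 58 * P then 0 else if n < 1682 * P then 1 else 2)"

text \<open>\<open>P\<close> and \<open>P'\<close> multiply up the odd primes below 29 found in
  \<open>q - 1\<close> and \<open>q + 1\<close>, because each one leaves less room for large prime
  factors.\<close>

fun scan :: "int \<Rightarrow> int \<Rightarrow> int \<Rightarrow> residue_entry list \<Rightarrow> int \<Rightarrow> int \<Rightarrow> int \<Rightarrow> int \<Rightarrow> int \<Rightarrow> bool" where
  "scan q u t [] P P' d x y = add_big q u t d x y (big_bound (q - 1) P) (big_bound (q + 1) P')"
| "scan q u t ((p, h, l, r) # ws) P P' d x y =
    (if r = 1 then scan q u t ws (p * P) P' (d - h) (x + l) y
     else if r + 1 = p then scan q u t ws P (p * P') (d - h) x (y + l)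
     else scan q u t ws P P' d x y)"

text \<open>Here r is \<open>q mod 3\<close>. If 3 divides \<open>q^2 - 1\<close> it is tried in the
  core first and as a sieved prime second; in the latter case 6666 and 6667 are 2/3 rounded down for
  d and up for x or y.\<close>

definition test_cores :: "int \<Rightarrow> int \<Rightarrow> int \<Rightarrow> residue_entry list \<Rightarrow> bool" where
  "test_cores q u r ws = (if r = 0 then scan q u 4 ws 1 1 10000 0 0
    else if r = 1 then scan q u 8 ws 3 1 10000 0 0 \<or> scan q u 4 ws 3 1 6666 6667 0
    else scan q (2 * u) 8 ws 1 3 10000 0 0 \<or> scan q u 4 ws 1 3 6666 0 6667)"

text \<open>The first entry belongs to the modulus 4, which is carried along only to read off
  \<open>q mod 4\<close>; the second belongs to 3.\<close>

fun test :: "int \<Rightarrow> residue_entry list \<Rightarrow> bool" where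
  "test q ((_, _, _, r4) # (_, _, _, r3) # ws) = test_cores q (if r4 = 3 then 4 else 2) r3 ws"
| "test q _ = False"

definition recip_above :: "int \<Rightarrow> int" where "recip_above p = 10000 div p + 1"
definition corecip_above :: "int \<Rightarrow> int" where "corecip_above p = 10000 - 10000 div p"

fun init :: "int \<Rightarrow> int list \<Rightarrow> residue_entry list" where
  "init q [] = []"
| "init q (p # ps) = (p, recip_above p, corecip_above p, q mod p) # init q ps"

fun step :: "residue_entry list \<Rightarrow> residue_entry list" where
  "step [] = []"
| "step ((p, h, l, r) # ws) = (p, h, l, if r + 2 < p then r + 2 else r + 2 - p) # step ws"

fun sweep :: "nat \<Rightarrow> int \<Rightarrow> residue_entry list \<Rightarrow> int list" where
  "sweep 0 q rs = []"
| "sweep (Suc n) q rs =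
    (if test q rs then sweep n (q + 2) (step rs) else q # sweep n (q + 2) (step rs))"

definition small_primes :: "int list" where "small_primes = [5, 7, 11, 13, 17, 19, 23]"

definition failures :: "nat \<Rightarrow> int \<Rightarrow> int list" where
  "failures n q = sweep n q (init q (4 # 3 # small_primes))"

section \<open>Soundness of the integer checker\<close>

lemma step_init:
  assumes "\<forall>p\<in>set ps. p \<ge> 3"
  shows "step (init q ps) = init (q + 2) ps"
  using assms
proof (induction ps)
  case (Cons p ps)
  have "(q + 2) mod p = (q mod p + 2) mod p" by (simp add: mod_simps)
  also have "\<dots> = (if q mod p + 2 < p then q mod p + 2 else q mod p + 2 - p)"
  proof (cases "q mod p + 2 < p")
    case True
    then show ?thesis using Cons.prems by (simp add: mod_pos_pos_trivial)
  next
    case False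
    have p: "3 \<le> p" using Cons.prems by simp
    then have "q mod p < p" by (intro pos_mod_bound) simp
    with p have lt: "q mod p + 2 - p < p" by linarith
    have "(q mod p + 2) mod p = (q mod p + 2 - p) mod p" by simp
    also have "\<dots> = q mod p + 2 - p"
      using False lt by (intro mod_pos_pos_trivial) simp_all
    finally show ?thesis using False by simp
  qed
  finally show ?case using Cons by simp
qed simp

lemma sweep_complete:
  assumes "\<forall>p\<in>set ps. p \<ge> 3" "i < n"
  shows "test (q + 2 * int i) (init (q + 2 * int i) ps) \<or> q + 2 * int i \<in> set (sweep n q (init q ps))"
  using assms(2)
proof (induction n arbitrary: q i)
  case (Suc n)
  show ?case
  proof (cases i)
    case 0
    then show ?thesis by simp
  next
    case (Suc j)
    have "test (q + 2 + 2 * int j) (init (q + 2 + 2 * int j) ps) \<or>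
        q + 2 + 2 * int j \<in> set (sweep n (q + 2) (init (q + 2) ps))"
      using Suc Suc.prems by (intro Suc.IH) simp
    then show ?thesis using Suc step_init[OF assms(1)] by (auto simp: algebra_simps)
  qed
qed simp

lemma scan_init:
  fixes q :: int
  defines "m \<equiv> filter (\<lambda>p. q mod p = 1)" and "n \<equiv> filter (\<lambda>p. q mod p \<noteq> 1 \<and> q mod p + 1 = p)"
  shows "scan q u t (init q ps) P P' d x y = add_big q u t
    (d - sum_list (map recip_above (m ps)) - sum_list (map recip_above (n ps)))
    (x + sum_list (map corecip_above (m ps))) (y + sum_list (map corecip_above (n ps)))
    (big_bound (q - 1) (prod_list (m ps) * P)) (big_bound (q + 1) (prod_list (n ps) * P'))"
  by (induction ps arbitrary: P P' d x y) (simp_all add: m_def n_def algebra_simps)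

lemma recip_above_bounds:
  assumes "p > 0"
  shows "10000 * (1 / real p) \<le> recip_above (int p)"
    and "10000 * (1 - 1 / real p) \<le> corecip_above (int p)"
proof -
  have "real_of_int (10000 div int p) = \<lfloor>10000 / real p\<rfloor>"
    using floor_divide_of_int_eq[of 10000 "int p", where 'a = real] by simp
  then have "real_of_int (10000 div int p) \<le> 10000 / real p" "10000 / real p < real_of_int (10000 div int p) + 1"
    by linarith+
  then show "10000 * (1 / real p) \<le> recip_above (int p)"
    and "10000 * (1 - 1 / real p) \<le> corecip_above (int p)"
    by (simp_all add: recip_above_def corecip_above_def algebra_simps)
qed

text \<open>The inequality is linear in sqrt q. Separating its rational part f from the coefficient
  h turns it into \<open>h * sqrt q < f\<close>; since f is positive, comparing squares decides it
  within the integers, and a negative h does no harm.\<close>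

lemma sieve_criterion_decide:
  fixes q :: nat and C :: "nat set" and u t d x y :: int
  defines "S \<equiv> odd_primes q - C"
  assumes q: "q > 1" "C \<subseteq> odd_primes q"
    and ut: "real_of_int u = num_trivial q C" "real_of_int t = num_chars C"
    and d: "real_of_int d \<le> 10000 * (1 - (\<Sum>r\<in>S. 1 / real r))"
    and x: "10000 * (\<Sum>r\<in>{r \<in> S. \<not> r dvd q + 1}. 1 - 1 / real r) \<le> x"
    and y: "10000 * (\<Sum>r\<in>{r \<in> S. r dvd q + 1}. 1 - 1 / real r) \<le> y"
    and dec: "decide (int q) u t d x y"
  shows "sieve_criterion q C"
proof -
  have finP: "finite (odd_primes q)" using q by (intro finite_odd_primes)
  then have fin: "finite C" "finite S" using q finite_subset by (auto simp: S_def)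
  define sm where "sm = (\<Sum>r\<in>{r \<in> S. \<not> r dvd q + 1}. 1 - 1 / real r)"
  define sp where "sp = (\<Sum>r\<in>{r \<in> S. r dvd q + 1}. 1 - 1 / real r)"
  define \<delta> where "\<delta> = 1 - (\<Sum>r\<in>S. 1 / real r)"
  have "0 \<le> 1 - 1 / real r" if "r \<in> S" for r
  proof -
    have "r \<in> odd_primes q" using that by (simp add: S_def)
    then have "r > 0" using odd_primesD(1) prime_gt_0_nat by blast
    then show ?thesis by simp
  qed
  then have sm0: "sm \<ge> 0" and sp0: "sp \<ge> 0" unfolding sm_def sp_def by (auto intro!: sum_nonneg)
  have mb0: "mixed_bound q C \<ge> 0"
    using num_trivial_le[OF fin(1), of q] num_trivial_ge_1[of q C] by (simp add: mixed_bound_def)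
  have nc0: "num_chars C * sqrt q \<ge> 0" by (simp add: num_chars_def)
  have "(\<Sum>r\<in>S. (1 - 1 / r) * char_bound q C r) =
      (\<Sum>r\<in>{r \<in> S. \<not> r dvd q + 1}. (1 - 1 / r) * char_bound q C r) +
      (\<Sum>r\<in>{r \<in> S. r dvd q + 1}. (1 - 1 / r) * char_bound q C r)"
    using fin by (subst sum.union_disjoint[symmetric]) (auto intro!: sum.cong)
  also have "\<dots> = sm * (num_chars C * sqrt q) + sp * mixed_bound q C"
    unfolding sm_def sp_def sum_distrib_right by (simp add: char_bound_def)
  finally have sum_eq: "(\<Sum>r\<in>S. (1 - 1 / r) * char_bound q C r) =
      sm * (num_chars C * sqrt q) + sp * mixed_bound q C" .
  define f where "f = d * (int q - u + 1) - u * y"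
  define h where "h = d * (t - u) + x * t + y * (t - u)"
  have acc: "0 \<le> d" "0 < f" "h * h * int q < f * f"
    using dec by (simp_all add: decide_def accept_def f_def h_def)
  have "(real_of_int h * sqrt q)\<^sup>2 < (real_of_int f)\<^sup>2"
  proof -
    have "real_of_int (h * h * int q) < real_of_int (f * f)" using acc(3) by (simp only: of_int_less_iff)
    then show ?thesis by (simp add: power2_eq_square mult_ac)
  qed
  then have "h * sqrt q < f" 
    by (rule power2_less_imp_less) (use acc(2) in simp)
  then have "x * (num_chars C * sqrt q) + y * mixed_bound q C < d * (q + 1 - mixed_bound q C)"
    by (simp add: f_def h_def mixed_bound_def algebra_simps flip: ut)
  moreover have "10000 * sm * (num_chars C * sqrt q) \<le> x * (num_chars C * sqrt q)"
    using x nc0 unfolding sm_def by (intro mult_right_mono)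
  moreover have "10000 * sp * mixed_bound q C \<le> y * mixed_bound q C"
    using y mb0 unfolding sp_def by (intro mult_right_mono)
  ultimately have less: "10000 * (sm * (num_chars C * sqrt q) + sp * mixed_bound q C) <
      d * (q + 1 - mixed_bound q C)" by (simp add: algebra_simps)
  \<comment> \<open>Replacing d by the true value requires the bracket to be positive. This comes
    for free, as the left side of the strict inequality is nonnegative.\<close>
  have "0 \<le> 10000 * (sm * (num_chars C * sqrt q) + sp * mixed_bound q C)"
    using sm0 sp0 mb0 nc0 by simp
  from le_less_trans[OF this less] have "0 < d * (q + 1 - mixed_bound q C)" .
  then have pos: "q + 1 - mixed_bound q C > 0" using acc(1) by (simp add: zero_less_mult_iff)
  have "d * (q + 1 - mixed_bound q C) \<le> 10000 * \<delta> * (q + 1 - mixed_bound q C)"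
    using d pos unfolding \<delta>_def by (intro mult_right_mono) auto
  with less have "sm * (num_chars C * sqrt q) + sp * mixed_bound q C < \<delta> * (q + 1 - mixed_bound q C)"
    by simp
  moreover have "\<delta> \<ge> 0" using acc(1) d unfolding \<delta>_def by simp
  ultimately show ?thesis
    using q(2) sum_eq unfolding sieve_criterion_def Let_def S_def \<delta>_def by (simp add: add.commute)
qed

text \<open>The primes in F, those in G and 2 are pairwise distinct divisors of n, so
  \<open>2 * \<Prod>G * 29 ^ card F\<close> is at most n. The bound 48778 is
  \<open>2 * 29^3\<close>, which excludes three large factors.\<close>

lemma card_big_primes_le:
  fixes n :: nat
  assumes n: "0 < n" "even n" "n < 48778"
    and G: "finite G" "\<And>p. p \<in> G \<Longrightarrow> prime p \<and> p \<noteq> 2 \<and> p < 29 \<and> p dvd n"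
  defines "F \<equiv> {r. prime r \<and> 29 \<le> r \<and> r dvd n}"
  shows "int (card F) \<le> big_bound (int n) (int (\<Prod>G))"
proof -
  have finF: "finite F"
  proof -
    have "finite {r. r dvd n}" using n by simp
    then show ?thesis by (rule finite_subset[rotated]) (auto simp: F_def)
  qed
  have disj: "G \<inter> F = {}" "2 \<notin> G \<union> F" using G(2) by (force simp: F_def)+
  have "\<Prod>(insert 2 (G \<union> F)) dvd n"
    using n G finF by (intro prod_primes_dvd) (auto simp: F_def)
  then have "\<Prod>(insert 2 (G \<union> F)) \<le> n" using n(1) by (rule dvd_imp_le)
  also have "\<Prod>(insert 2 (G \<union> F)) = 2 * (\<Prod>G * \<Prod>F)"
    using disj G(1) finF by (simp add: prod.union_disjoint)
  finally have le: "2 * (\<Prod>G * \<Prod>F) \<le> n" .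
  have "(\<Prod>r\<in>F. 29) \<le> \<Prod>F" by (rule prod_mono) (auto simp: F_def)
  then have "29 ^ card F \<le> \<Prod>F" by simp
  then have "2 * (\<Prod>G * 29 ^ card F) \<le> 2 * (\<Prod>G * \<Prod>F)" by simp
  with le have le': "2 * (\<Prod>G * 29 ^ card F) \<le> n" by (rule order.trans[rotated])
  have g: "1 \<le> \<Prod>G"
    using G prime_gt_0_nat by (intro Suc_leI[of 0, folded One_nat_def] prod_pos) auto
  have k: "card F < 3"
  proof (rule ccontr)
    assume "\<not> card F < 3"
    then have "29 ^ 3 \<le> (29::nat) ^ card F" by (intro power_increasing) auto
    then have "1 * 29 ^ 3 \<le> \<Prod>G * 29 ^ card F" using g by (intro mult_mono) auto
    then show False using le' n(3) by simp
  qed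
  consider "card F = 0" | "card F = 1" | "card F = 2" using k by linarith
  then show ?thesis
  proof cases
    case 2
    then have "58 * \<Prod>G \<le> n" using le' by simp
    then have "58 * int (\<Prod>G) \<le> int n" by linarith
    then show ?thesis using 2 by (simp add: big_bound_def)
  next
    case 3
    then have "1682 * \<Prod>G \<le> n" using le' by simp
    then have *: "1682 * int (\<Prod>G) \<le> int n" by linarith
    moreover have "58 * int (\<Prod>G) \<le> 1682 * int (\<Prod>G)" by linarith
    ultimately show ?thesis using 3 by (simp add: big_bound_def)
  qed (simp add: big_bound_def)
qed

lemma sum_list_int_image:
  assumes "distinct xs" "set xs = int ` A"
  shows "sum_list (map f xs) = (\<Sum>p\<in>A. f (int p))" "prod_list xs = int (\<Prod>A)"
proof -
  show "sum_list (map f xs) = (\<Sum>p\<in>A. f (int p))"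
    using assms by (simp add: sum_list_distinct_conv_sum_set sum.reindex)
  show "prod_list xs = int (\<Prod>A)"
    using prod.distinct_set_conv_list[OF assms(1), of "\<lambda>x. x"] assms
    by (simp add: prod.reindex)
qed

lemma sum_recip_above:
  assumes "finite A" "0 \<notin> A"
  shows "10000 * (\<Sum>p\<in>A. 1 / real p) \<le> (\<Sum>p\<in>A. recip_above (int p))"
    and "10000 * (\<Sum>p\<in>A. 1 - 1 / real p) \<le> (\<Sum>p\<in>A. corecip_above (int p))"
proof -
  have "p > 0" if "p \<in> A" for p using that assms(2) by (cases p) auto
  then show "10000 * (\<Sum>p\<in>A. 1 / real p) \<le> (\<Sum>p\<in>A. recip_above (int p))"
    and "10000 * (\<Sum>p\<in>A. 1 - 1 / real p) \<le> (\<Sum>p\<in>A. corecip_above (int p))"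
    unfolding of_int_sum sum_distrib_left using recip_above_bounds by (auto intro!: sum_mono)
qed

lemma sum_big_recips:
  assumes "\<forall>r\<in>F. 29 \<le> (r::nat)" "int (card F) \<le> a"
  shows "10000 * (\<Sum>r\<in>F. 1 / real r) \<le> 345 * a" "10000 * (\<Sum>r\<in>F. 1 - 1 / real r) \<le> 10000 * a"
proof -
  have a: "real (card F) \<le> real_of_int a" using assms(2) by linarith
  have "(\<Sum>r\<in>F. 1 / real r) \<le> real (card F) * (1 / 29)"
  proof (rule sum_bounded_above)
    fix r assume "r \<in> F"
    then have "29 \<le> real r" using assms(1) by force
    then show "1 / real r \<le> 1 / 29" by (intro divide_left_mono) auto
  qed
  then show "10000 * (\<Sum>r\<in>F. 1 / real r) \<le> 345 * a" using a by simp
  have "(\<Sum>r\<in>F. 1 - 1 / real r) \<le> real (card F) * 1" by (rule sum_bounded_above) simp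
  then show "10000 * (\<Sum>r\<in>F. 1 - 1 / real r) \<le> 10000 * a" using a by simp
qed

lemma int_mod_eq_iffs:
  fixes q p :: nat
  assumes "q > 0" "p > 2"
  shows "int q mod int p = 1 \<longleftrightarrow> p dvd q - 1"
    and "int q mod int p + 1 = int p \<longleftrightarrow> p dvd q + 1"
proof -
  have e: "int q - 1 = int (q - 1)" using assms(1) by simp
  have "int q mod int p = 1 mod int p \<longleftrightarrow> p dvd q - 1"
    unfolding mod_eq_dvd_iff e int_dvd_int_iff ..
  moreover have "1 mod int p = 1" using assms(2) by simp
  ultimately show "int q mod int p = 1 \<longleftrightarrow> p dvd q - 1" by (simp only:)
  have "int p dvd int (q + 1) - int p \<longleftrightarrow> int p dvd int (q + 1)"
    by (rule dvd_diff_left_iff) simp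
  moreover have "int q - (int p - 1) = int (q + 1) - int p" by simp
  ultimately have "int q mod int p = (int p - 1) mod int p \<longleftrightarrow> p dvd q + 1"
    unfolding mod_eq_dvd_iff by (simp only: int_dvd_int_iff)
  moreover have "(int p - 1) mod int p = int p - 1"
    using assms(2) by (intro mod_pos_pos_trivial) simp_all
  ultimately show "int q mod int p + 1 = int p \<longleftrightarrow> p dvd q + 1" by linarith
qed

lemma odd_primes_iff:
  assumes "q > 0"
  shows "r \<in> odd_primes q \<longleftrightarrow> prime r \<and> r \<noteq> 2 \<and> (r dvd q - 1 \<or> r dvd q + 1)"
proof -
  have e: "q\<^sup>2 - 1 = (q - 1) * (q + 1)"
    using assms by (simp add: power2_eq_square algebra_simps diff_mult_distrib)
  show ?thesis unfolding odd_primes_def e using prime_dvd_mult_iff[of r "q - 1" "q + 1"] by blast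
qed

lemma not_dvd_both:
  fixes q r :: nat
  assumes "prime r" "r \<noteq> 2" "r dvd q - 1" "q > 0"
  shows "\<not> r dvd q + 1"
proof
  assume "r dvd q + 1"
  then have "r dvd (q + 1) - (q - 1)" using assms(3) by (rule dvd_diff_nat)
  then have "r dvd 2" using assms(4) by simp
  then show False using assms(1,2) by (metis primes_dvd_imp_eq two_is_prime_nat)
qed

text \<open>The sieved primes fall into four known groups: possibly 3 (the set E), the small primes
  A and B dividing \<open>q - 1\<close> and \<open>q + 1\<close>, and the large ones, of which only
  the number is bounded. The limit on q makes the count of large primes valid for
  \<open>q + 1\<close> too.\<close>

lemma scan_sound:
  fixes q :: nat and C :: "nat set" and u t d x y :: int
  defines "E \<equiv> odd_primes q \<inter> {3} - C"
  assumes q: "odd q" "q \<ge> 3" "q < 48777" and C: "C \<subseteq> odd_primes q \<inter> {3}"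
    and ut: "real_of_int u = num_trivial q C" "real_of_int t = num_chars C"
    and d: "real_of_int d \<le> 10000 * (1 - (\<Sum>r\<in>E. 1 / real r))"
    and x: "10000 * (\<Sum>r\<in>{r \<in> E. \<not> r dvd q + 1}. 1 - 1 / real r) \<le> x"
    and y: "10000 * (\<Sum>r\<in>{r \<in> E. r dvd q + 1}. 1 - 1 / real r) \<le> y"
    and P: "P = (if 3 dvd q - 1 then 3 else 1)" "P' = (if 3 dvd q + 1 then 3 else 1)"
    and scan: "scan (int q) u t (init (int q) small_primes) P P' d x y"
  shows "sieve_criterion q C"
proof -
  define N where "N = {5, 7, 11, 13, 17, 19, 23 :: nat}"
  define A where "A = {p \<in> N. p dvd q - 1}"
  define B where "B = {p \<in> N. p dvd q + 1}"
  define F where "F = (\<lambda>n. {r. prime r \<and> 29 \<le> r \<and> r dvd (n :: nat)})"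
  let ?m = "filter (\<lambda>p. int q mod p = 1) small_primes"
  let ?n = "filter (\<lambda>p. int q mod p \<noteq> 1 \<and> int q mod p + 1 = p) small_primes"
  have N: "prime p \<and> p \<noteq> 2 \<and> p \<noteq> 3 \<and> 2 < p \<and> p < 29" if "p \<in> N" for p
    using that unfolding N_def by auto
  have set_small: "set small_primes = int ` N" by (simp add: small_primes_def N_def)
  have distinct: "distinct small_primes" by (simp add: small_primes_def)
  have AB: "\<not> p dvd q + 1" if "prime p" "p \<noteq> 2" "p dvd q - 1" for p
    using not_dvd_both that q by simp
  have setm: "set ?m = int ` A"
    using int_mod_eq_iffs(1)[of q] N q unfolding A_def set_filter set_small by fastforce
  have setn: "set ?n = int ` B"
    using int_mod_eq_iffs[of q] N q AB unfolding B_def set_filter set_small by fastforce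
  have fin: "finite A" "finite B" "0 \<notin> A" "0 \<notin> B" by (auto simp: A_def B_def N_def)
  have three: "3 \<notin> A" "3 \<notin> B" using N by (auto simp: A_def B_def)
  define a where "a = big_bound (int q - 1) (int (\<Prod>A) * P)"
  define b where "b = big_bound (int q + 1) (int (\<Prod>B) * P')"
  define d' where "d' = d - (\<Sum>p\<in>A. recip_above (int p)) - (\<Sum>p\<in>B. recip_above (int p)) - 345 * (a + b)"
  define x' where "x' = x + (\<Sum>p\<in>A. corecip_above (int p)) + 10000 * a"
  define y' where "y' = y + (\<Sum>p\<in>B. corecip_above (int p)) + 10000 * b"
  have dec: "decide (int q) u t d' x' y'"
    using scan
    unfolding scan_init sum_list_int_image[OF distinct_filter[OF distinct] setm]
      sum_list_int_image[OF distinct_filter[OF distinct] setn]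
      add_big_def a_def b_def d'_def x'_def y'_def .
  have cardA: "int (card (F (q - 1))) \<le> a"
  proof -
    \<comment> \<open>The prime 3 belongs to G even if it is in the core: it still takes up its
      share of \<open>q - 1\<close>.\<close>
    define G where "G = (if 3 dvd q - 1 then insert 3 A else A)"
    have "int (card (F (q - 1))) \<le> big_bound (int (q - 1)) (int (\<Prod>G))"
      unfolding F_def
    proof (rule card_big_primes_le)
      fix p assume "p \<in> G"
      then show "prime p \<and> p \<noteq> 2 \<and> p < 29 \<and> p dvd q - 1"
        using N by (auto simp: G_def A_def split: if_splits)
    qed (use q fin in \<open>auto simp: G_def\<close>)
    moreover have "int (\<Prod>G) = int (\<Prod>A) * P"
      using fin three unfolding G_def P by simp
    moreover have "int (q - 1) = int q - 1" using q by simp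
    ultimately show ?thesis unfolding a_def by (simp only:)
  qed
  have cardB: "int (card (F (q + 1))) \<le> b"
  proof -
    define G where "G = (if 3 dvd q + 1 then insert 3 B else B)"
    have "int (card (F (q + 1))) \<le> big_bound (int (q + 1)) (int (\<Prod>G))"
      unfolding F_def
    proof (rule card_big_primes_le)
      fix p assume "p \<in> G"
      then show "prime p \<and> p \<noteq> 2 \<and> p < 29 \<and> p dvd q + 1"
        using N by (auto simp: G_def B_def split: if_splits)
    qed (use q fin in \<open>auto simp: G_def\<close>)
    moreover have "int (\<Prod>G) = int (\<Prod>B) * P'"
      using fin three unfolding G_def P by simp
    moreover have "int (q + 1) = int q + 1" by simp
    ultimately show ?thesis unfolding b_def by (simp only:)
  qed
  have finF: "finite (F n)" if "n > 0" for n
  proof -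
    have "finite {r. r dvd n}" using that by simp
    then show ?thesis by (rule finite_subset[rotated]) (auto simp: F_def)
  qed
  have finF': "finite (F (q - 1))" "finite (F (q + 1))" using q by (auto intro: finF)
  have small: "r = 3 \<or> r \<in> N" if "r \<in> odd_primes q" "r < 29" for r
    using odd_primes_eq_3_or_ge_5[OF that(1)] prime_ge_5_less_61[of r] odd_primesD(1)[OF that(1)] that(2)
    by (auto simp: N_def)
  have C3: "r \<notin> C" if "r \<noteq> 3" for r using C that by auto
  have minus: "{r \<in> odd_primes q - C. \<not> r dvd q + 1} = {r \<in> E. \<not> r dvd q + 1} \<union> (A \<union> F (q - 1))"
  proof (intro equalityI subsetI)
    fix r assume "r \<in> {r \<in> odd_primes q - C. \<not> r dvd q + 1}"
    then have r: "r \<in> odd_primes q" "r \<notin> C" "\<not> r dvd q + 1" "prime r" "r dvd q - 1"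
      using odd_primes_iff[of q r] q by auto
    show "r \<in> {r \<in> E. \<not> r dvd q + 1} \<union> (A \<union> F (q - 1))"
      using small[OF r(1)] r by (cases "r < 29") (auto simp: E_def A_def F_def)
  next
    fix r assume r: "r \<in> {r \<in> E. \<not> r dvd q + 1} \<union> (A \<union> F (q - 1))"
    show "r \<in> {r \<in> odd_primes q - C. \<not> r dvd q + 1}"
    proof (cases "r \<in> E")
      case True
      then show ?thesis using r N by (auto simp: E_def A_def F_def)
    next
      case False
      then have "prime r" "r \<noteq> 2" "r \<noteq> 3" "r dvd q - 1" using r N by (auto simp: A_def F_def)
      then show ?thesis using AB C3 odd_primes_iff[of q r] q by auto
    qed
  qed
  have plus: "{r \<in> odd_primes q - C. r dvd q + 1} = {r \<in> E. r dvd q + 1} \<union> (B \<union> F (q + 1))"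
  proof (intro equalityI subsetI)
    fix r assume "r \<in> {r \<in> odd_primes q - C. r dvd q + 1}"
    then have r: "r \<in> odd_primes q" "r \<notin> C" "r dvd q + 1" "prime r"
      using odd_primesD by auto
    show "r \<in> {r \<in> E. r dvd q + 1} \<union> (B \<union> F (q + 1))"
      using small[OF r(1)] r by (cases "r < 29") (auto simp: E_def B_def F_def)
  next
    fix r assume r: "r \<in> {r \<in> E. r dvd q + 1} \<union> (B \<union> F (q + 1))"
    show "r \<in> {r \<in> odd_primes q - C. r dvd q + 1}"
    proof (cases "r \<in> E")
      case True
      then show ?thesis using r N by (auto simp: E_def B_def F_def)
    next
      case False
      then have "prime r" "r \<noteq> 2" "r \<noteq> 3" "r dvd q + 1" using r N by (auto simp: B_def F_def)
      then show ?thesis using C3 odd_primes_iff[of q r] q by auto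
    qed
  qed
  have finE: "finite E" by (simp add: E_def)
  have disj: "{r \<in> E. \<not> r dvd q + 1} \<inter> (A \<union> F (q - 1)) = {}" "A \<inter> F (q - 1) = {}"
    "{r \<in> E. r dvd q + 1} \<inter> (B \<union> F (q + 1)) = {}" "B \<inter> F (q + 1) = {}"
    using N by (force simp: E_def A_def B_def F_def)+
  have sum_minus: "(\<Sum>r\<in>{r \<in> odd_primes q - C. \<not> r dvd q + 1}. f r) =
      (\<Sum>r\<in>{r \<in> E. \<not> r dvd q + 1}. f r) + ((\<Sum>r\<in>A. f r) + (\<Sum>r\<in>F (q - 1). f r))" for f :: "nat \<Rightarrow> real"
    unfolding minus using fin finF' finE disj by (simp add: sum.union_disjoint)
  have sum_plus: "(\<Sum>r\<in>{r \<in> odd_primes q - C. r dvd q + 1}. f r) =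
      (\<Sum>r\<in>{r \<in> E. r dvd q + 1}. f r) + ((\<Sum>r\<in>B. f r) + (\<Sum>r\<in>F (q + 1). f r))" for f :: "nat \<Rightarrow> real"
    unfolding plus using fin finF' finE disj by (simp add: sum.union_disjoint)
  have split: "sum f S = sum f {r \<in> S. \<not> r dvd q + 1} + sum f {r \<in> S. r dvd q + 1}"
    if "finite S" for S and f :: "nat \<Rightarrow> real"
    using that by (subst sum.union_disjoint[symmetric]) (auto intro!: sum.cong)
  have finS: "finite (odd_primes q - C)" using q by (simp add: finite_odd_primes)
  note sA = sum_recip_above[OF fin(1,3)] and sB = sum_recip_above[OF fin(2,4)]
  have F_ge: "\<forall>r\<in>F (q - 1). 29 \<le> r" "\<forall>r\<in>F (q + 1). 29 \<le> r"
    by (simp_all add: F_def)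
  note sF = sum_big_recips[OF F_ge(1) cardA] sum_big_recips[OF F_ge(2) cardB]
  show ?thesis
  proof (rule sieve_criterion_decide[OF _ _ ut _ _ _ dec])
    have "d - ra - rb - 345 * (a + b) \<le> 10000 * (1 - (e1 + (sa + fa) + (e2 + (sb + fb))))"
      if "d \<le> 10000 * (1 - (e1 + e2))" "10000 * sa \<le> ra" "10000 * sb \<le> rb"
        "10000 * fa \<le> 345 * a" "10000 * fb \<le> 345 * b" for d a b ra rb sa sb e1 e2 fa fb :: real
      using that by simp
    from this[OF d[unfolded split[OF finE]] sA(1) sB(1) sF(1)[unfolded of_int_mult of_int_numeral]
        sF(3)[unfolded of_int_mult of_int_numeral]]
    show "real_of_int d' \<le> 10000 * (1 - (\<Sum>r\<in>odd_primes q - C. 1 / real r))"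
      unfolding d'_def split[OF finS] sum_minus sum_plus
      by (simp only: of_int_diff of_int_mult of_int_add of_int_numeral)
    have add3: "10000 * (e + (s + f)) \<le> e' + s' + f'"
      if "10000 * e \<le> e'" "10000 * s \<le> s'" "10000 * f \<le> f'" for e s f e' s' f' :: real
      using that by simp
    show "10000 * (\<Sum>r | r \<in> odd_primes q - C \<and> \<not> r dvd q + 1. 1 - 1 / real r) \<le> x'"
      using add3[OF x sA(2) sF(2)] unfolding x'_def sum_minus by (simp only: of_int_add)
    show "10000 * (\<Sum>r | r \<in> odd_primes q - C \<and> r dvd q + 1. 1 - 1 / real r) \<le> y'"
      using add3[OF y sB(2) sF(4)] unfolding y'_def sum_plus by (simp only: of_int_add)
  qed (use q C in auto)
qed

lemma num_trivial_singleton: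
  "num_trivial q {r} = (if q mod 4 = 3 then 4 else 2) * (if r dvd q + 1 then 2 else 1)"
proof -
  have "{s \<in> {r}. s dvd q + 1} = (if r dvd q + 1 then {r} else {})" by auto
  then show ?thesis unfolding num_trivial_def by simp
qed

lemma test_sound:
  fixes q :: nat
  assumes q: "odd q" "q \<ge> 3" "q < 48777"
    and test: "test (int q) (init (int q) (4 # 3 # small_primes))"
  shows "\<exists>C. sieve_criterion q C"
proof -
  define u where "u = (if q mod 4 = 3 then 4 else 2 :: int)"
  have "int q mod 4 = int (q mod 4)" by (simp add: zmod_int)
  then have "(if int q mod 4 = 3 then 4 else 2) = u" unfolding u_def by simp
  then have cores: "test_cores (int q) u (int q mod 3) (init (int q) small_primes)"
    using test by simp
  have u0: "real_of_int u = num_trivial q {}" "real_of_int 4 = num_chars {}"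
    by (simp_all add: u_def num_trivial_def num_chars_def)
  have dvd: "int q mod 3 = 1 \<longleftrightarrow> 3 dvd q - 1" "int q mod 3 = 2 \<longleftrightarrow> 3 dvd q + 1"
    using int_mod_eq_iffs[of q 3] q by auto
  have m3: "int q mod 3 = 0 \<or> int q mod 3 = 1 \<or> int q mod 3 = 2" by presburger
  have "prime (3 :: nat)" by simp
  then have mem: "3 \<in> odd_primes q \<longleftrightarrow> 3 dvd q - 1 \<or> 3 dvd q + 1"
    using q by (subst odd_primes_iff) auto
  consider (0) "int q mod 3 = 0" | (1) "int q mod 3 = 1" | (2) "int q mod 3 = 2"
    using m3 by blast
  then show ?thesis
  proof cases
    case 0
    then have n3: "3 \<notin> odd_primes q" "\<not> 3 dvd q - 1" "\<not> 3 dvd q + 1" using mem dvd by auto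
    have "sieve_criterion q {}"
      by (rule scan_sound[OF q _ u0, of 10000 0 0 1 1])
        (use n3 0 cores in \<open>simp_all add: test_cores_def\<close>)
    then show ?thesis ..
  next
    case 1
    then have n3: "3 \<in> odd_primes q" "3 dvd q - 1" "\<not> 3 dvd q + 1" using mem dvd by auto
    have E: "odd_primes q \<inter> {3} - {} = {3}" "{r \<in> {3}. \<not> r dvd q + 1} = {3}"
      "{r \<in> {3}. r dvd q + 1} = {}" using n3 by auto
    have u1: "real_of_int u = num_trivial q {3}" "real_of_int 8 = num_chars {3}"
      using n3 by (simp_all add: u_def num_trivial_singleton num_chars_def)
    from cores 1 consider "scan (int q) u 8 (init (int q) small_primes) 3 1 10000 0 0"
      | "scan (int q) u 4 (init (int q) small_primes) 3 1 6666 6667 0"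
      unfolding test_cores_def by auto
    then show ?thesis
    proof cases
      case 1
      have "sieve_criterion q {3}"
        by (rule scan_sound[OF q _ u1, of 10000 0 0 3 1]) (use n3 1 in simp_all)
      then show ?thesis ..
    next
      case 2
      have "sieve_criterion q {}"
        by (rule scan_sound[OF q _ u0, of 6666 6667 0 3 1], unfold E) (use n3 2 in simp_all)
      then show ?thesis ..
    qed
  next
    case 2
    then have n3: "3 \<in> odd_primes q" "\<not> 3 dvd q - 1" "3 dvd q + 1" using mem dvd by auto
    have E: "odd_primes q \<inter> {3} - {} = {3}" "{r \<in> {3}. \<not> r dvd q + 1} = {}"
      "{r \<in> {3}. r dvd q + 1} = {3}" using n3 by auto
    have u1: "real_of_int (2 * u) = num_trivial q {3}" "real_of_int 8 = num_chars {3}"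
      using n3 by (simp_all add: u_def num_trivial_singleton num_chars_def)
    from cores 2 consider "scan (int q) (2 * u) 8 (init (int q) small_primes) 1 3 10000 0 0"
      | "scan (int q) u 4 (init (int q) small_primes) 1 3 6666 0 6667"
      unfolding test_cores_def by auto
    then show ?thesis
    proof cases
      case 1
      have "sieve_criterion q {3}"
        by (rule scan_sound[OF q _ u1, of 10000 0 0 1 3]) (use n3 1 in simp_all)
      then show ?thesis ..
    next
      case 2
      have "sieve_criterion q {}"
        by (rule scan_sound[OF q _ u0, of 6666 0 6667 1 3], unfold E) (use n3 2 in simp_all)
      then show ?thesis ..
    qed
  qed
qed

section \<open>Exact tests and certificates for the remaining values\<close>

definition exact_test :: "int \<Rightarrow> int list \<Rightarrow> bool \<Rightarrow> bool" where
  "exact_test q L c \<longleftrightarrow> q * q - 1 = prod_list L \<and> (c \<longrightarrow> 3 \<in> set L) \<and>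
    decide q ((if q mod 4 = 3 then 4 else 2) * (if c \<and> (q + 1) mod 3 = 0 then 2 else 1)) (if c then 8 else 4)
      (10000 - sum_list (map recip_above (filter (\<lambda>p. p \<noteq> 2 \<and> (c \<longrightarrow> p \<noteq> 3)) (remdups L))))
      (sum_list (map corecip_above (filter (\<lambda>p. p \<noteq> 2 \<and> (c \<longrightarrow> p \<noteq> 3) \<and> (q + 1) mod p \<noteq> 0) (remdups L))))
      (sum_list (map corecip_above (filter (\<lambda>p. p \<noteq> 2 \<and> (c \<longrightarrow> p \<noteq> 3) \<and> (q + 1) mod p = 0) (remdups L))))"

text \<open>With the complete factorisation nothing is lost by treating every large prime as 29. The
  executable test does not check that the entries of \<open>L\<close> are prime; this is left to the
  hypothesis here.\<close>

lemma exact_test_sound: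
  fixes q :: nat and L :: "nat list"
  assumes q: "q > 1" and L: "\<And>p. p \<in> set L \<Longrightarrow> prime p"
    and test: "exact_test (int q) (map int L) c"
  shows "\<exists>C. sieve_criterion q C"
proof -
  define C where "C = (if c then {3} else {} :: nat set)"
  define S where "S = odd_primes q - C"
  have "int (q\<^sup>2 - 1) = int q * int q - 1" using q by (simp add: power2_eq_square of_nat_diff)
  also have "\<dots> = prod_list (map int L)" using test by (simp add: exact_test_def)
  also have "\<dots> = int (prod_list L)" by (induction L) simp_all
  finally have prod: "q\<^sup>2 - 1 = prod_list L" by (simp only: of_nat_eq_iff)
  have P: "odd_primes q = set L - {2}"
  proof (intro equalityI subsetI)
    fix r assume "r \<in> odd_primes q"
    then have r: "prime r" "r \<noteq> 2" "r dvd prod_list L" using prod by (auto simp: odd_primes_def)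
    from r(3) obtain p where "p \<in> set L" "r dvd p"
      using r(1) by (induction L) (auto simp: prime_dvd_mult_iff)
    then show "r \<in> set L - {2}" using r L primes_dvd_imp_eq by auto
  next
    fix r assume "r \<in> set L - {2}"
    then have r: "r \<in> set L" "r \<noteq> 2" by auto
    from r(1) have "r dvd prod_list L" by (induction L) auto
    then show "r \<in> odd_primes q" using r L prod by (simp add: odd_primes_def)
  qed
  have C: "C \<subseteq> odd_primes q" using test by (auto simp: C_def P exact_test_def)
  have mod_iff: "(int q + 1) mod int p = 0 \<longleftrightarrow> p dvd q + 1" for p
  proof -
    have "int q + 1 = int (q + 1)" by simp
    then show ?thesis by (simp only: mod_eq_0_iff_dvd int_dvd_int_iff)
  qed
  let ?f = "\<lambda>p. p \<noteq> 2 \<and> (c \<longrightarrow> p \<noteq> 3)"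
  have d: "distinct (filter Q (remdups (map int L)))" for Q by simp
  have im: "set (filter Q (remdups (map int L))) = int ` {p \<in> set L. Q (int p)}" for Q by auto
  have s: "set (filter ?f (remdups (map int L))) = int ` S"
    unfolding im by (rule arg_cong[of _ _ "image int"]) (auto simp: S_def P C_def)
  have s1: "set (filter (\<lambda>p. p \<noteq> 2 \<and> (c \<longrightarrow> p \<noteq> 3) \<and> (int q + 1) mod p \<noteq> 0) (remdups (map int L))) =
      int ` {r \<in> S. \<not> r dvd q + 1}"
    unfolding im mod_iff by (rule arg_cong[of _ _ "image int"]) (auto simp: S_def P C_def)
  have s2: "set (filter (\<lambda>p. p \<noteq> 2 \<and> (c \<longrightarrow> p \<noteq> 3) \<and> (int q + 1) mod p = 0) (remdups (map int L))) =
      int ` {r \<in> S. r dvd q + 1}"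
    unfolding im mod_iff by (rule arg_cong[of _ _ "image int"]) (auto simp: S_def P C_def)
  have "int q mod 4 = int (q mod 4)" by (simp add: zmod_int)
  then have q4: "int q mod 4 = 3 \<longleftrightarrow> q mod 4 = 3" by linarith
  have q3: "(int q + 1) mod 3 = 0 \<longleftrightarrow> 3 dvd q + 1" using mod_iff[of 3] by simp
  have dec: "decide (int q) ((if q mod 4 = 3 then 4 else 2) * (if c \<and> 3 dvd q + 1 then 2 else 1))
      (if c then 8 else 4) (10000 - (\<Sum>p\<in>S. recip_above (int p)))
      (\<Sum>p\<in>{r \<in> S. \<not> r dvd q + 1}. corecip_above (int p))
      (\<Sum>p\<in>{r \<in> S. r dvd q + 1}. corecip_above (int p))"
    using test unfolding exact_test_def q4 q3 sum_list_int_image(1)[OF d s]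
      sum_list_int_image(1)[OF d s1] sum_list_int_image(1)[OF d s2] by blast
  have fin: "finite S" "0 \<notin> S" using L[of 0] by (auto simp: S_def P)
  have ut: "real_of_int ((if q mod 4 = 3 then 4 else 2) * (if c \<and> 3 dvd q + 1 then 2 else 1)) = num_trivial q C"
    "real_of_int (if c then 8 else 4) = num_chars C"
    by (cases c; simp add: C_def num_trivial_singleton; simp add: num_trivial_def)
      (simp add: C_def num_chars_def)
  have "sieve_criterion q C"
  proof (rule sieve_criterion_decide[OF q C _ _ _ _ _ dec], fold S_def)
    show "real_of_int (10000 - (\<Sum>p\<in>S. recip_above (int p))) \<le> 10000 * (1 - (\<Sum>r\<in>S. 1 / real r))"
      using sum_recip_above(1)[OF fin] by simp
    show "10000 * (\<Sum>r | r \<in> S \<and> \<not> r dvd q + 1. 1 - 1 / real r)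
        \<le> real_of_int (\<Sum>p | p \<in> S \<and> \<not> p dvd q + 1. corecip_above (int p))"
      using fin by (intro sum_recip_above(2)) auto
    show "10000 * (\<Sum>r | r \<in> S \<and> r dvd q + 1. 1 - 1 / real r)
        \<le> real_of_int (\<Sum>p | p \<in> S \<and> p dvd q + 1. corecip_above (int p))"
      using fin by (intro sum_recip_above(2)) auto
  qed (rule ut)+
  then show ?thesis ..
qed

lemma not_primepow_mult:
  fixes a b :: nat
  assumes "a > 1" "b > 1" "coprime a b"
  shows "\<not> primepow (a * b)"
proof
  assume "primepow (a * b)"
  then obtain p k where p: "prime p" "a * b = p ^ k" by (auto simp: primepow_def)
  obtain r s where "prime r" "r dvd a" "prime s" "s dvd b"
    using assms prime_factor_nat by (metis less_irrefl)
  moreover have "r dvd p ^ k" "s dvd p ^ k"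
    using \<open>r dvd a\<close> \<open>s dvd b\<close> unfolding p(2)[symmetric] by simp_all
  ultimately have "r = p" "s = p" using p(1) by (metis prime_dvd_power primes_dvd_imp_eq)+
  then show False
    using \<open>r dvd a\<close> \<open>s dvd b\<close> assms(3) p(1) by (metis coprime_common_divisor_nat not_prime_1)
qed

lemma prime_if_no_small_divisor:
  fixes n :: nat
  assumes "1 < n" "n < 3721"
    and "\<forall>p\<in>{2, 3, 5, 7, 11, 13, 17, 19, 23, 29, 31, 37, 41, 43, 47, 53, 59}. \<not> p dvd n"
  shows "prime n"
proof (rule ccontr)
  assume "\<not> prime n"
  then obtain p where p: "prime p" "p dvd n" "p\<^sup>2 \<le> n"
    using assms(1) prime_prime_factor_sqrt[of n] by auto
  have "p\<^sup>2 < 61\<^sup>2" using p(3) assms(2) by simp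
  then have "p < 61" by (rule power_less_imp_less_base) simp
  moreover have "p = 2 \<or> p = 3 \<or> 5 \<le> p"
  proof -
    have "p \<noteq> 4" using p(1) primes_dvd_imp_eq[of 2 4] by auto
    then show ?thesis using prime_ge_2_nat[OF p(1)] by linarith
  qed
  ultimately have "p \<in> {2, 3, 5, 7, 11, 13, 17, 19, 23, 29, 31, 37, 41, 43, 47, 53, 59}"
    using prime_ge_5_less_61[OF p(1)] by auto
  then show False using assms(3) p(2) by blast
qed

definition special_primes :: "nat list" where
  "special_primes = [2, 3, 5, 7, 11, 13, 17, 19, 23, 29, 31, 37, 41, 43, 47, 53, 59, 61, 67, 71, 97,
     107, 137, 139, 227, 577, 683, 2311]"

lemma prime_special_primes: "p \<in> set special_primes \<Longrightarrow> prime p"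
proof -
  have "prime (61::nat)" "prime (67::nat)" "prime (71::nat)" "prime (97::nat)" "prime (107::nat)"
    "prime (137::nat)" "prime (139::nat)" "prime (227::nat)" "prime (577::nat)" "prime (683::nat)"
    "prime (2311::nat)"
    by (rule prime_if_no_small_divisor; simp)+
  moreover have "\<forall>p\<in>{2, 3, 5, 7, 11, 13, 17, 19, 23, 29, 31, 37, 41, 43, 47, 53, 59}. prime (p :: nat)"
    by simp
  moreover assume "p \<in> set special_primes"
  ultimately show "prime p" unfolding special_primes_def set_simps by blast
qed

text \<open>
  The entries are \<open>q\<close>, the prime factors of $q^2 - 1$ with multiplicity, and whether $3$ is in the core.
\<close>
definition special_cases :: "(int \<times> int list \<times> bool) list" where
  "special_cases = [
     (193, [2, 2, 2, 2, 2, 2, 2, 3, 97], True), (233, [2, 2, 2, 2, 3, 3, 13, 29], False), (277,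
     [2, 2, 2, 3, 23, 139], False), (289, [2, 2, 2, 2, 2, 2, 3, 3, 5, 29], False), (401, [2, 2,
     2, 2, 2, 3, 5, 5, 67], True), (433, [2, 2, 2, 2, 2, 3, 3, 3, 7, 31], True), (449, [2, 2, 2,
     2, 2, 2, 2, 3, 3, 5, 5, 7], True), (491, [2, 2, 2, 3, 5, 7, 7, 41], True), (547, [2, 2, 2,
     3, 7, 13, 137], False), (641, [2, 2, 2, 2, 2, 2, 2, 2, 3, 5, 107], True), (709, [2, 2, 2,
     3, 5, 59, 71], False), (821, [2, 2, 2, 3, 5, 41, 137], True), (961, [2, 2, 2, 2, 2, 2, 2,
     3, 5, 13, 37], False), (1409, [2, 2, 2, 2, 2, 2, 2, 2, 3, 5, 11, 47], True), (1471, [2, 2,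
     2, 2, 2, 2, 2, 3, 5, 7, 7, 23], True), (1481, [2, 2, 2, 2, 3, 5, 13, 19, 37], True), (1681,
     [2, 2, 2, 2, 2, 3, 5, 7, 29, 29], True), (1709, [2, 2, 2, 3, 3, 5, 7, 19, 61], True),
     (1721, [2, 2, 2, 2, 3, 5, 7, 41, 43], True), (1801, [2, 2, 2, 2, 3, 3, 5, 5, 17, 53],
     True), (2269, [2, 2, 2, 3, 3, 3, 3, 5, 7, 227], True), (2309, [2, 2, 2, 3, 5, 7, 11, 577],
     True), (2521, [2, 2, 2, 2, 3, 3, 5, 7, 13, 97], True), (2731, [2, 2, 2, 3, 5, 7, 13, 683],
     True), (3571, [2, 2, 2, 3, 5, 7, 17, 19, 47], True), (4621, [2, 2, 2, 3, 5, 7, 11, 2311],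
     True)]"

text \<open>Among the odd numbers failing the test there are some that are not prime powers; a
  factorisation into coprime parts greater than 1 proves this for each of them.\<close>

definition coprime_pairs :: "(int \<times> int) list" where
  "coprime_pairs = [
     (3, 5), (3, 7), (5, 7), (9, 5), (3, 19), (5, 13), (3, 23), (7, 11), (5, 17), (7, 13), (3,
     37), (5, 23), (3, 43), (7, 19), (3, 47), (9, 17), (5, 31), (5, 37), (5, 41), (11, 19), (7,
     31), (13, 17), (11, 23), (7, 37), (5, 53), (7, 43), (3, 103), (11, 29), (3, 107), (7, 47),
     (11, 31), (5, 73), (17, 23), (7, 67), (17, 29), (5, 101), (7, 73), (11, 47), (13, 41), (5,
     109), (13, 43), (7, 83), (19, 31), (17, 37), (11, 59), (7, 107), (11, 71), (17, 47), (11,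
     79), (17, 53), (25, 37), (23, 43), (19, 59), (29, 41), (23, 53), (13, 97), (11, 131), (23,
     67), (7, 223), (11, 149), (13, 127), (31, 61), (7, 283), (11, 191), (17, 257)]"

lemma special_cases_ok: "list_all (\<lambda>(q, L, c). exact_test q L c) special_cases"
  by code_simp

lemma special_cases_primes: "\<forall>(q, L, c)\<in>set special_cases. set L \<subseteq> int ` set special_primes"
  by (simp add: special_cases_def special_primes_def)

lemma coprime_pairs_ok: "list_all (\<lambda>(a, b). 1 < a \<and> 1 < b \<and> gcd a b = 1) coprime_pairs"
  by code_simp

definition exceptional_list :: "int list" where
  "exceptional_list = [
     3, 5, 7, 9, 11, 13, 17, 19, 23, 25, 27, 29, 31, 37, 41, 43, 47, 49, 53, 59, 61, 67, 71,
     73, 79, 81, 83, 89, 97, 101, 103, 109, 113, 121, 125, 127, 131, 137, 139, 149, 151, 157,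
     169, 173, 181, 191, 197, 199, 211, 229, 239, 241, 269, 281, 307, 311, 331, 337, 349, 361,
     373, 379, 389, 409, 419, 421, 461, 463, 509, 521, 529, 569, 571, 601, 617, 631, 659, 661,
     701, 761, 769, 841, 859, 881, 911, 1009, 1021, 1231, 1289, 1301, 1331, 1429, 1609, 1741,
     1849, 1861, 2029, 2281, 2311, 2729, 3541]"

lemma exceptional_q_eq: "exceptional_q = nat ` set exceptional_list"
  by (simp add: exceptional_q_def exceptional_list_def)

definition classified :: "int \<Rightarrow> bool" where
  "classified x \<longleftrightarrow> x \<in> set exceptional_list \<or> x \<in> set (map fst special_cases) \<or>
     x \<in> set (map (\<lambda>(a, b). a * b) coprime_pairs)"

text \<open>Every odd number below 5003 that fails the test is exceptional, is settled by its
  factorisation, or is not a prime power. The start values are odd and each unit of the count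
  advances by 2.\<close>

lemma failures_classified:
  "list_all classified (failures 1250 3)"
  "list_all classified (failures 1250 2503)"
  by code_simp+

text \<open>From 5003 on all odd numbers in the range pass, whether they are prime powers or
  not.\<close>

lemma no_failures_1: "failures 1500 5003 = []" "failures 1500 8003 = []"
  by code_simp+

lemma no_failures_2: "failures 1500 11003 = []" "failures 1500 14003 = []"
  by code_simp+

lemma no_failures_3: "failures 1500 17003 = []" "failures 1500 20003 = []"
  by code_simp+

lemma no_failures_4: "failures 1500 23003 = []"
  by code_simp

lemma failures_complete:
  fixes q a n :: nat
  assumes "odd q" "odd a" "3 \<le> a" "a \<le> q" "q < a + 2 * n" "q < 48777"
  shows "(\<exists>C. sieve_criterion q C) \<or> int q \<in> set (failures n (int a))"
proof -
  define i where "i = (q - a) div 2"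
  have "even (q - a)" using assms(1,2) by simp
  then have "2 * i = q - a" by (simp add: i_def)
  then have i: "int a + 2 * int i = int q" "i < n" using assms(4,5) by linarith+
  have "test (int q) (init (int q) (4 # 3 # small_primes)) \<or> int q \<in> set (failures n (int a))"
    using sweep_complete[of "4 # 3 # small_primes" i n "int a"] i
    by (simp add: failures_def small_primes_def)
  then show ?thesis using test_sound[of q] assms by auto
qed

lemma sieve_criterion_small:
  assumes "odd q" "primepow q" "q \<notin> exceptional_q" "q < 26000"
  shows "\<exists>C. sieve_criterion q C"
proof (cases "q < 5003")
  case True
  have "1 < q" using primepow_gt_Suc_0[OF assms(2)] by simp
  moreover have "q \<noteq> 2" using assms(1) by auto
  ultimately have q: "3 \<le> q" by linarith
  have "(\<exists>C. sieve_criterion q C) \<or> classified (int q)"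
  proof (cases "q < 2503")
    case True
    then show ?thesis
      using failures_complete[of q 3 1250] failures_classified(1) assms(1) q
      unfolding list_all_iff by auto
  next
    case False
    then show ?thesis
      using failures_complete[of q 2503 1250] failures_classified(2) assms(1) \<open>q < 5003\<close>
      unfolding list_all_iff by auto
  qed
  moreover have "int q \<notin> set exceptional_list"
    using assms(3) unfolding exceptional_q_eq by (metis image_eqI nat_int)
  ultimately consider "\<exists>C. sieve_criterion q C" | "int q \<in> fst ` set special_cases"
    | "int q \<in> (\<lambda>(a, b). a * b) ` set coprime_pairs"
    unfolding classified_def set_map by blast
  then show ?thesis
  proof cases
    case 2
    then obtain L c where L: "(int q, L, c) \<in> set special_cases" by auto
    then have test: "exact_test (int q) L c" and sub: "set L \<subseteq> int ` set special_primes"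
      using special_cases_ok special_cases_primes by (auto simp: list_all_iff)
    have "map int (map nat L) = L" using sub by (auto intro!: map_idI)
    moreover have "prime p" if "p \<in> set (map nat L)" for p
      using that sub prime_special_primes by auto
    ultimately show ?thesis using exact_test_sound[of q "map nat L" c] test q by auto
  next
    case 3
    then obtain a b where ab: "(a, b) \<in> set coprime_pairs" "int q = a * b" by auto
    then have gt: "1 < a" "1 < b" and gcd: "gcd a b = 1"
      using coprime_pairs_ok by (auto simp: list_all_iff)
    define a' where "a' = nat a"
    define b' where "b' = nat b"
    have a': "a = int a'" "1 < a'" and b': "b = int b'" "1 < b'"
      using gt by (simp_all add: a'_def b'_def)
    have "coprime a' b'" using gcd unfolding a' b' by (simp add: coprime_iff_gcd_eq_1)
    moreover have "q = a' * b'" using ab(2) unfolding a' b' by (simp flip: of_nat_mult)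
    ultimately show ?thesis using not_primepow_mult[of a' b'] a' b' assms(2) by simp
  qed
next
  case False
  have chunk: "\<exists>C. sieve_criterion q C"
    if "odd a" "3 \<le> a" "a \<le> q" "q < a + 3000" "failures 1500 (int a) = []" for a
    using failures_complete[of q a 1500] that assms(1,4) by simp
  from False consider "5003 \<le> q" "q < 8003" | "8003 \<le> q" "q < 11003" | "11003 \<le> q" "q < 14003"
    | "14003 \<le> q" "q < 17003" | "17003 \<le> q" "q < 20003" | "20003 \<le> q" "q < 23003"
    | "23003 \<le> q" "q < 26003" using assms(4) by linarith
  then show ?thesis
  proof cases
    case 1
    then show ?thesis by (intro chunk[of 5003]) (simp_all add: no_failures_1)
  next
    case 2
    then show ?thesis by (intro chunk[of 8003]) (simp_all add: no_failures_1)
  next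
    case 3
    then show ?thesis by (intro chunk[of 11003]) (simp_all add: no_failures_2)
  next
    case 4
    then show ?thesis by (intro chunk[of 14003]) (simp_all add: no_failures_2)
  next
    case 5
    then show ?thesis by (intro chunk[of 17003]) (simp_all add: no_failures_3)
  next
    case 6
    then show ?thesis by (intro chunk[of 20003]) (simp_all add: no_failures_3)
  next
    case 7
    then show ?thesis by (intro chunk[of 23003]) (simp_all add: no_failures_4)
  qed
qed

section \<open>The line of prescribed trace\<close>

context cring begin

lemma binomial_theorem:
  assumes x: "x \<in> carrier R" and y: "y \<in> carrier R"
  shows "(x \<oplus> y) [^] (n::nat) = (\<Oplus>k\<in>{..n}. add_pow R (n choose k) (x [^] k \<otimes> y [^] (n - k)))"
proof (induction n)
  case 0
  then show ?case using x y by simp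
next
  case (Suc n)
  define f where "f = (\<lambda>n k. add_pow R (n choose k) (x [^] k \<otimes> y [^] (n - k)))"
  define m where "m = (\<lambda>k. x [^] k \<otimes> y [^] (Suc n - k))"
  have m: "m k \<in> carrier R" and f: "f i k \<in> carrier R" for i k
    using x y by (simp_all add: m_def f_def)
  have "(x \<oplus> y) [^] Suc n = (\<Oplus>k\<in>{..n}. f n k) \<otimes> (x \<oplus> y)"
    using Suc by (simp add: f_def)
  also have "\<dots> = (\<Oplus>k\<in>{..n}. f n k) \<otimes> x \<oplus> (\<Oplus>k\<in>{..n}. f n k) \<otimes> y"
    using x y f by (intro r_distr finsum_closed) auto
  also have "(\<Oplus>k\<in>{..n}. f n k) \<otimes> x = (\<Oplus>k\<in>{..n}. add_pow R (n choose k) (m (Suc k)))"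
  proof -
    have "f n k \<otimes> x = add_pow R (n choose k) (m (Suc k))" for k
      using x y unfolding f_def m_def by (subst add_pow_ldistr) (simp_all add: m_ac)
    moreover have "(\<Oplus>k\<in>{..n}. f n k) \<otimes> x = (\<Oplus>k\<in>{..n}. f n k \<otimes> x)"
      using x f by (intro finsum_ldistr) auto
    ultimately show ?thesis by simp
  qed
  also have "(\<Oplus>k\<in>{..n}. f n k) \<otimes> y = (\<Oplus>k\<in>{..n}. add_pow R (n choose k) (m k))"
  proof -
    have "f n k \<otimes> y = add_pow R (n choose k) (m k)" if "k \<le> n" for k
      using x y that unfolding f_def m_def
      by (subst add_pow_ldistr) (simp_all add: m_assoc Suc_diff_le)
    moreover have "(\<Oplus>k\<in>{..n}. f n k) \<otimes> y = (\<Oplus>k\<in>{..n}. f n k \<otimes> y)"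
      using y f by (intro finsum_ldistr) auto
    ultimately show ?thesis using m by (auto intro!: finsum_cong')
  qed
  \<comment> \<open>The added term has coefficient \<open>n choose Suc n = 0\<close>. It makes room
    for splitting off the index 0 and shifting, so that Pascal's rule applies term by term.\<close>
  also have "\<dots> = (\<Oplus>k\<in>{..Suc n}. add_pow R (n choose k) (m k))"
    using m by (subst finsum_Suc) (auto simp: binomial_eq_0)
  also have "\<dots> = (\<Oplus>k\<in>{..n}. add_pow R (n choose Suc k) (m (Suc k))) \<oplus> add_pow R (n choose 0) (m 0)"
    using m by (intro finsum_Suc2) auto
  also have "(\<Oplus>k\<in>{..n}. add_pow R (n choose k) (m (Suc k))) \<oplus>
      ((\<Oplus>k\<in>{..n}. add_pow R (n choose Suc k) (m (Suc k))) \<oplus> add_pow R (n choose 0) (m 0)) =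
      (\<Oplus>k\<in>{..n}. add_pow R (n choose k) (m (Suc k)) \<oplus> add_pow R (n choose Suc k) (m (Suc k)))
      \<oplus> add_pow R (n choose 0) (m 0)"
    using m by (subst finsum_addf) (auto simp: a_assoc)
  also have "\<dots> = (\<Oplus>k\<in>{..n}. f (Suc n) (Suc k)) \<oplus> f (Suc n) 0"
  proof -
    have "f (Suc n) k = add_pow R (Suc n choose k) (m k)" for k by (simp only: f_def m_def)
    then show ?thesis using m by (simp add: add.nat_pow_mult)
  qed
  also have "\<dots> = (\<Oplus>k\<in>{..Suc n}. f (Suc n) k)"
    using f by (intro finsum_Suc2[symmetric]) auto
  finally show ?case by (simp only: f_def)
qed

lemma frobenius_add:
  assumes p: "prime (p::nat)" "[p] \<cdot> \<one> = \<zero>" and x: "x \<in> carrier R" and y: "y \<in> carrier R"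
  shows "(x \<oplus> y) [^] p = x [^] p \<oplus> y [^] p"
proof -
  let ?f = "\<lambda>k. add_pow R (p choose k) (x [^] k \<otimes> y [^] (p - k))"
  have f: "?f k \<in> carrier R" for k using x y by simp
  have mult: "[(p * m)] \<cdot> a = \<zero>" if a: "a \<in> carrier R" for a and m :: nat
  proof -
    have "[p] \<cdot> ([m] \<cdot> a) = ([p] \<cdot> \<one>) \<otimes> ([m] \<cdot> a)" using a by (simp add: add_pow_ldistr)
    then show ?thesis using a p(2) by (simp add: add.nat_pow_pow mult.commute)
  qed
  have zero: "?f k = \<zero>" if "0 < k" "k < p" for k
  proof -
    have "p dvd (p choose k)" using that p(1) by (intro dvd_choose_prime) auto
    then obtain m where "p choose k = p * m" by (elim dvdE)
    then show ?thesis using mult x y by simp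
  qed
  obtain m where m: "p = Suc (Suc m)"
    using prime_ge_2_nat[OF p(1)] by (metis add_2_eq_Suc le_Suc_ex)
  have "(x \<oplus> y) [^] p = (\<Oplus>k\<in>{..Suc (Suc m)}. ?f k)"
    unfolding binomial_theorem[OF x y] m ..
  also have "\<dots> = ?f (Suc (Suc m)) \<oplus> (\<Oplus>k\<in>{..Suc m}. ?f k)"
    using f by (intro finsum_Suc) auto
  also have "(\<Oplus>k\<in>{..Suc m}. ?f k) = (\<Oplus>k\<in>{..m}. ?f (Suc k)) \<oplus> ?f 0"
    using f by (intro finsum_Suc2) auto
  also have "(\<Oplus>k\<in>{..m}. ?f (Suc k)) = (\<Oplus>k\<in>{..m}. \<zero>)"
  proof (intro finsum_cong')
    fix k assume "k \<in> {..m}"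
    then show "?f (Suc k) = \<zero>" by (intro zero) (auto simp: m)
  qed auto
  also have "\<dots> = \<zero>" by (rule finsum_zero) 
  finally show ?thesis using x y m by simp
qed

lemma frobenius_power_add:
  assumes p: "prime (p::nat)" "[p] \<cdot> \<one> = \<zero>" and x: "x \<in> carrier R" and y: "y \<in> carrier R"
  shows "(x \<oplus> y) [^] (p ^ n) = x [^] (p ^ n) \<oplus> y [^] (p ^ n)"
proof (induction n)
  case (Suc n)
  have "(x \<oplus> y) [^] (p ^ Suc n) = ((x \<oplus> y) [^] (p ^ n)) [^] p"
    using x y by (simp add: nat_pow_pow mult.commute)
  also have "\<dots> = (x [^] (p ^ n)) [^] p \<oplus> (y [^] (p ^ n)) [^] p"
    unfolding Suc using x y by (intro frobenius_add p) auto
  finally show ?case using x y by (simp add: nat_pow_pow mult.commute)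
qed (use x y in simp)

end

text \<open>The additive group is annihilated by its order \<open>p ^ n\<close>, so the n-th power
  of \<open>[p] \<cdot> \<one>\<close> is zero, and a domain has no nilpotent elements except
  zero.\<close>

lemma (in domain) characteristic_of_order:
  assumes "order R = p ^ n" "prime (p::nat)" "finite (carrier R)"
  shows "[p] \<cdot> \<one> = \<zero>"
proof -
  have pow: "[(p ^ m)] \<cdot> \<one> = ([p] \<cdot> \<one>) [^] m" for m :: nat
  proof (induction m)
    case (Suc m)
    have "[(p ^ Suc m)] \<cdot> \<one> = [(p ^ m)] \<cdot> ([p] \<cdot> \<one>)"
      by (simp add: add.nat_pow_pow mult.commute)
    also have "\<dots> = ([(p ^ m)] \<cdot> \<one>) \<otimes> ([p] \<cdot> \<one>)" by (simp add: add_pow_ldistr)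
    finally show ?case using Suc by simp
  qed simp
  have "[(order R)] \<cdot> \<one> = \<zero>"
    using add.pow_order_eq_1[of \<one>] by (simp add: order_def)
  then have "([p] \<cdot> \<one>) [^] n = \<zero>" using pow assms(1) by simp
  moreover have "a = \<zero>" if "a [^] m = \<zero>" "a \<in> carrier R" for a and m :: nat
    using that by (induction m) (auto dest: integral)
  ultimately show ?thesis by simp
qed

section \<open>The field with \<open>q^2\<close> elements and its generator\<close>

locale quadratic_extension = field F for F :: "('a, 'b) ring_scheme" (structure) +
  fixes K :: "'a set" and q :: nat
  assumes odd_q: "odd q" and primepow_q: "primepow q" and order_F: "order F = q\<^sup>2"
    and subfield_K: "subfield K F" and card_K: "card K = q"
begin

definition Q :: nat where "Q = q\<^sup>2 - 1"

lemma q_gt_1: "q > 1"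
  using primepow_gt_Suc_0[OF primepow_q] by simp

lemma Q_factor: "Q = (q - 1) * (q + 1)"
  using q_gt_1 by (simp add: Q_def power2_eq_square algebra_simps diff_mult_distrib)

lemma Q_pos: "Q > 0"
  using q_gt_1 by (simp add: Q_factor)

lemma int_Q: "int Q = (int q)\<^sup>2 - 1"
proof -
  have "1 \<le> q\<^sup>2" using q_gt_1 by simp
  then show ?thesis unfolding Q_def by (simp add: of_nat_diff)
qed

lemma finite_F: "finite (carrier F)"
proof -
  have "card (carrier F) > 0" using order_F q_gt_1 by (simp add: order_def)
  then show ?thesis by (rule card_ge_0_finite)
qed

lemma frobenius_q:
  assumes "x \<in> carrier F" "y \<in> carrier F"
  shows "(x \<oplus> y) [^] q = x [^] q \<oplus> y [^] q"
proof -
  obtain p n where p: "prime p" "q = p ^ n"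
    using primepow_q by (auto simp: primepow_def)
  have "order F = p ^ (n * 2)" using order_F p by (simp add: power_mult)
  then have "[p] \<cdot> \<one> = \<zero>" using p finite_F by (intro characteristic_of_order)
  then show ?thesis using frobenius_power_add[OF p(1)] assms unfolding p(2) by blast
qed

lemma frobenius_minus:
  assumes "x \<in> carrier F" "y \<in> carrier F"
  shows "(x \<ominus> y) [^] q = x [^] q \<ominus> y [^] q"
proof -
  have "x [^] q = ((x \<ominus> y) \<oplus> y) [^] q" using assms by (simp add: a_minus_def a_assoc l_neg)
  also have "\<dots> = (x \<ominus> y) [^] q \<oplus> y [^] q" using assms by (intro frobenius_q) auto
  finally show ?thesis using assms by (simp add: a_minus_def a_assoc r_neg)
qed

lemma exists_generator:
  "\<exists>g\<in>carrier F. (\<forall>k::nat. g [^] k \<noteq> \<zero>) \<and> (\<forall>x\<in>carrier F - {\<zero>}. \<exists>k::nat. x = g [^] k) \<and>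
     (\<forall>a b :: nat. g [^] a = g [^] b \<longleftrightarrow> [a = b] (mod Q)) \<and>
     (\<forall>k::nat. k > 0 \<longrightarrow> group.ord (mult_of F) (g [^] k) = Q div gcd Q k)"
proof -
  \<comment> \<open>Two constants named \<open>mult_of\<close> with the same meaning are in scope;
    they have to be identified before the results about the multiplicative group apply.\<close>
  have same: "Ring_Divisibility.mult_of F = Multiplicative_Group.mult_of F"
    by (simp add: Ring_Divisibility.mult_of_def Multiplicative_Group.mult_of_def)
  interpret G: group "Multiplicative_Group.mult_of F" by (rule field_mult_group)
  note pow = Multiplicative_Group.nat_pow_mult_of[of F]
  obtain g where g: "g \<in> carrier F - {\<zero>}" "carrier F - {\<zero>} = {g [^] i | i::nat. i \<in> UNIV}"
    using finite_field_mult_group_has_gen[OF finite_F] by auto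
  have g': "g \<in> carrier (Multiplicative_Group.mult_of F)" using g by simp
  have fin: "finite (carrier (Multiplicative_Group.mult_of F))" using finite_F by simp
  have "generate (Multiplicative_Group.mult_of F) {g} = carrier (Multiplicative_Group.mult_of F)"
    unfolding G.generate_pow_on_finite_carrier[OF fin g'] pow using g(2) by simp
  then have "G.ord g = card (carrier F - {\<zero>})" using G.generate_pow_card[OF g'] by simp
  then have ord: "G.ord g = Q"
    using order_F finite_F by (simp add: Q_def order_def card_Diff_singleton)
  have "g [^] a = g [^] b \<longleftrightarrow> [a = b] (mod Q)" for a b :: nat
  proof -
    have "g [^] a = g [^] b \<longleftrightarrow> int Q dvd int b - int a"
      using G.int_pow_eq[OF g', of "int a" "int b"] ord by (simp add: int_pow_int pow)
    also have "\<dots> \<longleftrightarrow> [int b = int a] (mod int Q)" by (simp add: cong_iff_dvd_diff)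
    finally show ?thesis by (simp add: cong_int_iff cong_sym_eq)
  qed
  moreover have "group.ord (mult_of F) (g [^] k) = Q div gcd Q k" if "k > 0" for k :: nat
    using G.ord_pow_gen[OF g', of k] that unfolding same pow ord by simp
  moreover have "g [^] k \<noteq> \<zero>" for k :: nat using g by blast
  ultimately show ?thesis using g by (intro bexI[of _ g]) blast+
qed

lemma K_fixed:
  assumes "u \<in> K"
  shows "u [^] q = u"
proof (cases "u = \<zero>")
  case True
  then show ?thesis using q_gt_1 by (simp add: nat_pow_zero)
next
  case False
  let ?K = "F\<lparr>carrier := K\<rparr>"
  interpret K: field ?K using subfield_iff(2)[OF subfield_K] .
  interpret H: group "Multiplicative_Group.mult_of ?K" by (rule K.field_mult_group)
  have fin: "finite (carrier ?K)" using card_K q_gt_1 by (simp add: card_ge_0_finite)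
  have "order (Multiplicative_Group.mult_of ?K) = q - 1"
    using K.order_mult_of[OF fin] card_K by (simp add: order_def)
  moreover have "u \<in> carrier (Multiplicative_Group.mult_of ?K)" using assms False by simp
  ultimately have "u [^]\<^bsub>?K\<^esub> (q - 1) = \<one>"
    using H.pow_order_eq_1[of u] by (simp add: Multiplicative_Group.nat_pow_mult_of)
  then have "u [^] (q - 1) = \<one>" by (simp add: nat_pow_def)
  then have "u [^] Suc (q - 1) = u" using subfieldE(3)[OF subfield_K] assms by auto
  then show ?thesis using q_gt_1 by simp
qed

end

section \<open>Exponents of the elements of prescribed trace\<close>

locale trace_line = quadratic_extension +
  fixes g :: 'a and \<beta> :: 'a
  assumes g_closed [simp]: "g \<in> carrier F" and g_pow_nonzero [simp]: "\<And>k::nat. g [^] k \<noteq> \<zero>"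
    and g_generates: "\<And>x. x \<in> carrier F - {\<zero>} \<Longrightarrow> \<exists>k::nat. x = g [^] k"
    and g_pow_eq_iff: "\<And>a b :: nat. g [^] a = g [^] b \<longleftrightarrow> [a = b] (mod Q)"
    and beta: "\<beta> \<in> K - {\<zero>}"
begin

definition D :: "nat set" where
  "D = {k \<in> {0..<Q}. quad_trace F q (g [^] k) = \<beta>}"

lemma beta_closed: "\<beta> \<in> carrier F" "\<beta> \<noteq> \<zero>"
  using beta subfieldE(3)[OF subfield_K] by auto

lemma trace_closed [simp]: "x \<in> carrier F \<Longrightarrow> quad_trace F q x \<in> carrier F"
  by (simp add: quad_trace_def)

lemma trace_minus:
  assumes "x \<in> carrier F" "y \<in> carrier F"
  shows "quad_trace F q (x \<ominus> y) = quad_trace F q x \<ominus> quad_trace F q y"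
proof -
  have "(x \<ominus> y) \<oplus> (x' \<ominus> y') = (x \<oplus> x') \<ominus> (y \<oplus> y')"
    if "x' \<in> carrier F" "y' \<in> carrier F" for x' y'
    using that assms by (simp add: a_minus_def minus_add a_ac)
  then show ?thesis using assms by (simp add: quad_trace_def frobenius_minus)
qed

lemma trace_scale:
  assumes "u \<in> carrier F" "x \<in> carrier F" "u [^] q = u"
  shows "quad_trace F q (u \<otimes> x) = u \<otimes> quad_trace F q x"
  using assms by (simp add: quad_trace_def nat_pow_distrib r_distr)

lemma fixed_iff_dvd: "(g [^] k) [^] q = g [^] k \<longleftrightarrow> (q + 1) dvd k" for k :: nat
proof -
  have "(g [^] k) [^] q = g [^] k \<longleftrightarrow> [k * q = k] (mod Q)"
    by (simp add: nat_pow_pow g_pow_eq_iff)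
  also have "\<dots> \<longleftrightarrow> Q dvd k * q - k"
    using q_gt_1 by (intro cong_altdef_nat) simp
  also have "k * q - k = k * (q - 1)" by (simp add: diff_mult_distrib2)
  also have "Q dvd k * (q - 1) \<longleftrightarrow> (q + 1) dvd k"
    unfolding Q_factor mult.commute[of k] by (rule nat_mult_dvd_cancel1) (use q_gt_1 in simp)
  finally show ?thesis .
qed

lemma frobenius_twice:
  assumes "x \<in> carrier F"
  shows "(x [^] q) [^] q = x"
proof (cases "x = \<zero>")
  case True
  then show ?thesis using q_gt_1 by (simp add: nat_pow_zero)
next
  case False
  then obtain k :: nat where k: "x = g [^] k" using g_generates assms by blast
  have "q * q = Q + 1" using q_gt_1 by (simp add: Q_def power2_eq_square)
  then have "k * (q * q) = k + k * Q" by (simp add: algebra_simps)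
  then have "[k * (q * q) = k] (mod Q)" by (simp add: cong_def)
  then show ?thesis unfolding k by (simp add: nat_pow_pow g_pow_eq_iff mult.assoc)
qed

lemma trace_fixed:
  assumes "x \<in> carrier F"
  shows "quad_trace F q x [^] q = quad_trace F q x"
  using assms by (simp add: quad_trace_def frobenius_q frobenius_twice a_comm)

text \<open>An element has trace zero iff the Frobenius map negates it. If this holds for both y and
  u * y, then u itself is fixed, so its exponent is a multiple of \<open>q + 1\<close>.\<close>

lemma trace_kernel_ratio:
  assumes "y \<in> carrier F" "y \<noteq> \<zero>" "quad_trace F q y = \<zero>" "quad_trace F q (g [^] t \<otimes> y) = \<zero>"
  shows "(q + 1) dvd t"
proof -
  let ?u = "g [^] t"
  have y: "y [^] q = \<ominus> y"
    using assms(1,3) unfolding quad_trace_def by (metis minus_equality a_comm nat_pow_closed)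
  have "\<ominus> (?u \<otimes> y) = (?u \<otimes> y) [^] q"
    using assms(1,4) unfolding quad_trace_def by (metis minus_equality a_comm nat_pow_closed m_closed g_closed)
  also have "\<dots> = \<ominus> (?u [^] q \<otimes> y)" using assms(1) y by (simp add: nat_pow_distrib r_minus)
  finally have "?u \<otimes> y = ?u [^] q \<otimes> y"
    using assms(1) by (metis minus_minus m_closed nat_pow_closed g_closed)
  then have "?u = ?u [^] q" using assms(1,2) m_rcancel by simp
  then show ?thesis using fixed_iff_dvd by metis
qed

text \<open>A residue modulo \<open>q + 1\<close> is a coset of K^*. If the trace z on a
  representative is not zero, scaling by \<open>\<beta> \<otimes> inv z\<close>, which is fixed by
  the Frobenius map, moves the trace to \<beta> without leaving the coset.\<close>

lemma D_lift:
  assumes "quad_trace F q (g [^] c) \<noteq> \<zero>" "c \<le> q"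
  shows "c \<in> (\<lambda>k. k mod (q + 1)) ` D"
proof -
  define z where "z = quad_trace F q (g [^] c)"
  have z: "z \<in> carrier F" "z \<noteq> \<zero>" "z [^] q = z" using assms trace_fixed by (simp_all add: z_def)
  then have iz: "inv z \<in> carrier F" "inv z \<otimes> z = \<one>" using field_Units by auto
  define u where "u = \<beta> \<otimes> inv z"
  have u: "u \<in> carrier F" "u \<otimes> z = \<beta>" using iz z beta_closed by (simp_all add: u_def m_assoc)
  then have "u [^] q \<otimes> z = \<beta>" using z K_fixed beta nat_pow_distrib[of u z q] by auto
  then have uq: "u [^] q = u" using u z m_rcancel[of z "u [^] q" u] by simp
  have "u \<noteq> \<zero>" using u z beta_closed by auto
  then obtain m :: nat where m: "u = g [^] m" using g_generates u by blast
  then have dvd: "(q + 1) dvd m" using uq fixed_iff_dvd by simp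
  define k where "k = (c + m) mod Q"
  have "g [^] k = g [^] (c + m)" unfolding g_pow_eq_iff k_def by (simp add: cong_def)
  also have "\<dots> = u \<otimes> g [^] c" unfolding m by (simp add: nat_pow_mult add.commute)
  finally have "quad_trace F q (g [^] k) = \<beta>" using u uq trace_scale z_def by simp
  then have "k \<in> D" using Q_pos by (simp add: D_def k_def)
  moreover have "k mod (q + 1) = c"
  proof -
    have "k mod (q + 1) = (c + m) mod (q + 1)"
      unfolding k_def by (rule mod_mod_cancel) (unfold Q_factor, rule dvd_triv_right)
    also have "\<dots> = c mod (q + 1)"
    proof -
      obtain l where "m = (q + 1) * l" using dvd by (elim dvdE)
      then show ?thesis by (simp only: mod_mult_self2)
    qed
    finally show ?thesis using assms(2) by simp
  qed
  ultimately show ?thesis by force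
qed

lemma finite_D: "finite D"
  by (simp add: D_def)

text \<open>Of the \<open>q + 1\<close> cosets of K^* at most one lies in the kernel of the trace;
  each of the others contributes an element of D.\<close>

lemma card_D_ge: "q \<le> card D"
proof -
  define Z where "Z = {c \<in> {0..q}. quad_trace F q (g [^] c) = \<zero>}"
  have le: "c = c'" if "c \<in> Z" "c' \<in> Z" "c \<le> c'" for c c'
  proof -
    have "g [^] c' = g [^] (c' - c) \<otimes> g [^] c" using that by (simp add: nat_pow_mult)
    then have "(q + 1) dvd c' - c"
      using that trace_kernel_ratio[of "g [^] c" "c' - c"] by (simp add: Z_def)
    moreover have "c' \<le> q" using that by (simp add: Z_def)
    then have "c' - c < q + 1" by linarith
    ultimately have "c' - c = 0" using nat_dvd_not_less by blast
    then show ?thesis using that by simp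
  qed
  have "\<forall>a\<in>Z. \<forall>b\<in>Z. a = b" using le nat_le_linear by metis
  moreover have "finite Z" by (simp add: Z_def)
  ultimately have "card Z \<le> 1" using card_le_Suc0_iff_eq by (metis One_nat_def)
  then have "q \<le> card ({0..q} - Z)"
    by (subst card_Diff_subset) (auto simp: Z_def)
  also have "\<dots> \<le> card ((\<lambda>k. k mod (q + 1)) ` D)"
  proof (rule card_mono)
    show "{0..q} - Z \<subseteq> (\<lambda>k. k mod (q + 1)) ` D"
    proof
      fix c assume "c \<in> {0..q} - Z"
      then show "c \<in> (\<lambda>k. k mod (q + 1)) ` D" by (intro D_lift) (auto simp: Z_def)
    qed
  qed (use finite_D in simp)
  also have "\<dots> \<le> card D" using finite_D by (rule card_image_le)
  finally show ?thesis .
qed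

abbreviation pairs :: "(nat \<times> nat) set" where
  "pairs \<equiv> {(a, b) \<in> D \<times> D. a \<noteq> b}"

text \<open>Q is added before subtracting b so that the natural subtraction never truncates.\<close>

definition diff :: "nat \<times> nat \<Rightarrow> nat" where
  "diff = (\<lambda>(a, b). (a + Q - b) mod Q)"

lemma g_pow_diff:
  assumes "a < Q" "b < Q"
  shows "g [^] a = g [^] diff (a, b) \<otimes> g [^] b"
proof -
  have "[diff (a, b) + b = a] (mod Q)"
    using assms by (simp add: diff_def cong_def mod_simps)
  then have "g [^] a = g [^] (diff (a, b) + b)" unfolding g_pow_eq_iff by (rule cong_sym)
  then show ?thesis by (simp add: nat_pow_mult)
qed

lemma diff_not_dvd:
  assumes "(a, b) \<in> pairs"
  shows "\<not> (q + 1) dvd diff (a, b)"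
proof
  assume dvd: "(q + 1) dvd diff (a, b)"
  have ab: "a < Q" "b < Q" "quad_trace F q (g [^] a) = \<beta>" "quad_trace F q (g [^] b) = \<beta>" "a \<noteq> b"
    using assms by (auto simp: D_def)
  have "\<beta> = g [^] diff (a, b) \<otimes> \<beta>"
    using ab trace_scale[of "g [^] diff (a, b)" "g [^] b"] dvd fixed_iff_dvd
      g_pow_diff[OF ab(1,2)] by simp
  then have "g [^] diff (a, b) = \<one>"
    using beta_closed m_rcancel[of \<beta> "g [^] diff (a, b)" \<one>] by simp
  then have "g [^] a = g [^] b" using g_pow_diff[OF ab(1,2)] by simp
  then show False using ab by (simp add: g_pow_eq_iff cong_def)
qed

text \<open>If two pairs have the same difference t, then y = g^b - g^b' and g^t * y = g^a - g^a'
  both have trace zero. Unless y = 0, this makes t a multiple of \<open>q + 1\<close>, which no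
  difference is.\<close>

lemma inj_on_diff: "inj_on diff pairs"
proof (rule inj_onI, clarify)
  fix a b a' b'
  assume ab: "a \<in> D" "b \<in> D" "a \<noteq> b" "a' \<in> D" "b' \<in> D" "a' \<noteq> b'"
    and eq: "diff (a, b) = diff (a', b')"
  have lt: "a < Q" "b < Q" "a' < Q" "b' < Q" and tr: "quad_trace F q (g [^] k) = \<beta>" if "k \<in> D" for k
    using ab that by (auto simp: D_def)
  define y where "y = g [^] b \<ominus> g [^] b'"
  have "y = \<zero>"
  proof (rule ccontr)
    assume "y \<noteq> \<zero>"
    moreover have "quad_trace F q y = \<zero>"
      unfolding y_def using ab tr beta_closed by (subst trace_minus) (simp_all add: a_minus_def r_neg)
    moreover have "g [^] diff (a, b) \<otimes> y = g [^] a \<ominus> g [^] a'"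
      unfolding y_def using g_pow_diff[of a b] g_pow_diff[of a' b'] eq ab lt
      by (simp add: a_minus_def r_distr r_minus)
    moreover have "quad_trace F q (g [^] a \<ominus> g [^] a') = \<zero>"
      using ab tr beta_closed by (subst trace_minus) (simp_all add: a_minus_def r_neg)
    ultimately have "(q + 1) dvd diff (a, b)"
      by (intro trace_kernel_ratio[of y]) (simp_all add: y_def)
    then show False using diff_not_dvd[of a b] ab by simp
  qed
  then have gb: "g [^] b = g [^] b'" by (simp add: y_def)
  then have "b = b'" using ab lt by (simp add: g_pow_eq_iff cong_def)
  moreover have "g [^] a = g [^] a'"
    using g_pow_diff[of a b] g_pow_diff[of a' b'] eq gb ab lt by simp
  then have "a = a'" using ab lt by (simp add: g_pow_eq_iff cong_def)
  ultimately show "a = a' \<and> b = b'" by simp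
qed

lemma card_non_multiples: "card {t \<in> {0..<Q}. \<not> (q + 1) dvd t} = q * (q - 1)"
proof -
  have "{t \<in> {0..<Q}. (q + 1) dvd t} = (\<lambda>i. (q + 1) * i) ` {0..<q - 1}"
    unfolding Q_factor by (auto elim!: dvdE simp: mult.commute simp del: mult_Suc mult_Suc_right)
  moreover have "inj_on (\<lambda>i. (q + 1) * i) {0..<q - 1}"
    by (rule inj_onI) (metis add_is_0 mult_cancel1 one_neq_zero)
  ultimately have "card {t \<in> {0..<Q}. (q + 1) dvd t} = q - 1"
    by (simp only: card_image card_atLeastLessThan diff_zero)
  moreover have "{t \<in> {0..<Q}. \<not> (q + 1) dvd t} = {0..<Q} - {t \<in> {0..<Q}. (q + 1) dvd t}" by auto
  moreover have "card ({0..<Q} - {t \<in> {0..<Q}. (q + 1) dvd t}) =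
      card {0..<Q} - card {t \<in> {0..<Q}. (q + 1) dvd t}"
    by (rule card_Diff_subset) auto
  ultimately have "card {t \<in> {0..<Q}. \<not> (q + 1) dvd t} = Q - (q - 1)"
    by (simp only: card_atLeastLessThan diff_zero)
  also have "\<dots> = q * (q - 1)" unfolding Q_factor by (cases q) simp_all
  finally show ?thesis .
qed

lemma card_pairs: "card pairs = card D * card D - card D"
proof -
  have "pairs = D \<times> D - (\<lambda>a. (a, a)) ` D" by auto
  then show ?thesis
    using finite_D by (simp add: card_Diff_subset image_subset_iff card_image inj_on_def)
qed

lemma diff_pairs_subset: "diff ` pairs \<subseteq> {t \<in> {0..<Q}. \<not> (q + 1) dvd t}"
  using diff_not_dvd Q_pos by (auto simp: diff_def)

text \<open>The differences of a larger D would not fit: \<open>(q + 1) * q\<close> distinct values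
  among \<open>q * (q - 1)\<close> possible ones. Thus injectivity gives the size of D, and then
  surjectivity follows by counting.\<close>

lemma card_D: "card D = q"
proof (rule ccontr)
  assume "card D \<noteq> q"
  then have "q + 1 \<le> card D" using card_D_ge by simp
  then have "(q + 1) * q \<le> card D * (card D - 1)" by (intro mult_le_mono) auto
  also have "\<dots> = card (diff ` pairs)"
    unfolding card_image[OF inj_on_diff] card_pairs by (simp add: diff_mult_distrib2)
  also have "\<dots> \<le> card {t \<in> {0..<Q}. \<not> (q + 1) dvd t}"
    by (rule card_mono[OF _ diff_pairs_subset]) simp
  also have "\<dots> = q * (q - 1)" by (rule card_non_multiples)
  finally show False using q_gt_1 by (simp add: algebra_simps diff_mult_distrib2)
qed

lemma bij_betw_diff: "bij_betw diff pairs {t \<in> {0..<Q}. \<not> (q + 1) dvd t}"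
  unfolding bij_betw_def
proof (intro conjI inj_on_diff card_subset_eq diff_pairs_subset)
  show "card (diff ` pairs) = card {t \<in> {0..<Q}. \<not> (q + 1) dvd t}"
    unfolding card_image[OF inj_on_diff] card_pairs card_D card_non_multiples
    by (simp add: diff_mult_distrib2)
qed simp

text \<open>Transport from natural numbers to integers: the difference map is conjugated by the
  embedding \<open>int\<close> on both sides.\<close>

lemma relative_difference_set_D: "relative_difference_set q (int ` D) (int Q)"
proof
  have "bij_betw (map_prod int int) pairs {(a, b) \<in> int ` D \<times> int ` D. a \<noteq> b}"
    by (rule bij_betw_imageI) (auto simp: inj_on_def)
  then have inv: "bij_betw (inv_into pairs (map_prod int int)) {(a, b) \<in> int ` D \<times> int ` D. a \<noteq> b} pairs"
    by (rule bij_betw_inv_into)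
  have "bij_betw int {t \<in> {0..<Q}. \<not> (q + 1) dvd t} {t \<in> {0..<int Q}. \<not> (int q + 1) dvd t}"
  proof (rule bij_betw_byWitness[where f' = nat])
    have dvd: "(int q + 1) dvd int t \<longleftrightarrow> (q + 1) dvd t" for t
      by (metis int_dvd_int_iff of_nat_1 of_nat_add)
    show "int ` {t \<in> {0..<Q}. \<not> (q + 1) dvd t} \<subseteq> {t \<in> {0..<int Q}. \<not> (int q + 1) dvd t}"
    proof (rule image_subsetI)
      fix t assume "t \<in> {t \<in> {0..<Q}. \<not> (q + 1) dvd t}"
      then show "int t \<in> {t \<in> {0..<int Q}. \<not> (int q + 1) dvd t}" using dvd[of t] by simp
    qed
    show "nat ` {t \<in> {0..<int Q}. \<not> (int q + 1) dvd t} \<subseteq> {t \<in> {0..<Q}. \<not> (q + 1) dvd t}"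
    proof (rule image_subsetI)
      fix t assume t: "t \<in> {t \<in> {0..<int Q}. \<not> (int q + 1) dvd t}"
      then obtain s where s: "t = int s" by (auto elim: nonneg_int_cases)
      show "nat t \<in> {t \<in> {0..<Q}. \<not> (q + 1) dvd t}" using t dvd[of s] unfolding s by simp
    qed
  qed auto
  from bij_betw_trans[OF bij_betw_trans[OF inv bij_betw_diff] this]
  have "bij_betw (int \<circ> (diff \<circ> inv_into pairs (map_prod int int)))
      {(a, b) \<in> int ` D \<times> int ` D. a \<noteq> b} {t \<in> {0..<int Q}. \<not> (int q + 1) dvd t}" .
  moreover have "(int \<circ> (diff \<circ> inv_into pairs (map_prod int int))) x = (case x of (a, b) \<Rightarrow> (a - b) mod int Q)"
    if x: "x \<in> {(a, b) \<in> int ` D \<times> int ` D. a \<noteq> b}" for x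
  proof -
    obtain a b where ab: "x = (int a, int b)" "(a, b) \<in> pairs" using x by auto
    have "inv_into pairs (map_prod int int) (map_prod int int (a, b)) = (a, b)"
      using ab(2) by (intro inv_into_f_f) (auto simp: inj_on_def)
    moreover have "int (diff (a, b)) = (int a - int b) mod int Q"
    proof -
      have "b \<le> a + Q" using ab(2) by (auto simp: D_def)
      then have "int (diff (a, b)) = (int a - int b + int Q) mod int Q"
        by (simp add: diff_def zmod_int of_nat_diff algebra_simps)
      then show ?thesis by simp
    qed
    ultimately show ?thesis by (simp add: ab(1))
  qed
  ultimately show "bij_betw (\<lambda>(a, b). (a - b) mod int Q) {(a, b) \<in> int ` D \<times> int ` D. a \<noteq> b}
      {t \<in> {0..<int Q}. \<not> (int q + 1) dvd t}"
    by (subst bij_betw_cong[symmetric]) auto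
qed (use odd_q q_gt_1 finite_D card_D int_Q in \<open>auto simp: card_image\<close>)

end

section \<open>Existence of 2-primitive elements\<close>

text \<open>The order of \<open>g^k\<close> is Q divided by \<open>gcd Q k\<close>, so a 2-primitive
  power needs this gcd to be 2. The class of 2 modulo 4 fixes the power of 2, and the last
  hypothesis excludes odd common factors.\<close>

lemma gcd_eq_2I:
  fixes n k :: nat
  assumes "n > 0" "even n" "k mod 4 = 2" "\<And>r. prime r \<Longrightarrow> r \<noteq> 2 \<Longrightarrow> r dvd n \<Longrightarrow> \<not> r dvd k"
  shows "gcd n k = 2"
proof (rule ccontr)
  assume neq: "gcd n k \<noteq> 2"
  have "even k" using assms(3) by presburger
  then have "2 dvd gcd n k" using assms(2) by simp
  then obtain e where e: "gcd n k = 2 * e" by (elim dvdE)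
  have "e \<noteq> 1" using neq e by simp
  then obtain r where r: "prime r" "r dvd e" using prime_factor_nat by blast
  have "2 * r dvd 2 * e" using r(2) by simp
  then have rk: "2 * r dvd n" "2 * r dvd k" unfolding e[symmetric] by simp_all
  show False
  proof (cases "r = 2")
    case True
    then have "4 dvd k" using rk(2) by simp
    then show False using assms(3) by presburger
  next
    case False
    then show False using assms(4)[OF r(1)] rk dvd_mult_right by blast
  qed
qed

theorem theorem6p8:
  fixes F :: "('a, 'b) ring_scheme" and K :: "'a set" and q :: nat
  assumes "odd q" and "primepow q" and "q \<notin> exceptional_q"
    and "field F" and "order F = q\<^sup>2"
    and "subfield K F" and "card K = q"
  shows "\<forall>\<beta> \<in> K - {\<zero>\<^bsub>F\<^esub>}. \<exists>\<xi> \<in> carrier F. two_primitive F q \<xi> \<and> quad_trace F q \<xi> = \<beta>"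
proof
  fix \<beta> assume beta: "\<beta> \<in> K - {\<zero>\<^bsub>F\<^esub>}"
  interpret E: quadratic_extension F K q
    using assms by (intro quadratic_extension.intro quadratic_extension_axioms.intro)
  obtain g where g: "g \<in> carrier F" "\<And>k::nat. g [^]\<^bsub>F\<^esub> k \<noteq> \<zero>\<^bsub>F\<^esub>"
    "\<And>x. x \<in> carrier F - {\<zero>\<^bsub>F\<^esub>} \<Longrightarrow> \<exists>k::nat. x = g [^]\<^bsub>F\<^esub> k"
    "\<And>a b :: nat. g [^]\<^bsub>F\<^esub> a = g [^]\<^bsub>F\<^esub> b \<longleftrightarrow> [a = b] (mod E.Q)"
    "\<And>k::nat. k > 0 \<Longrightarrow> group.ord (mult_of F) (g [^]\<^bsub>F\<^esub> k) = E.Q div gcd E.Q k"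
    using E.exists_generator by blast
  interpret L: trace_line F K q g \<beta>
    by unfold_locales (use g beta in auto)
  interpret R: relative_difference_set q "int ` L.D" "int E.Q"
    by (rule L.relative_difference_set_D)
  obtain C where "sieve_criterion q C"
    using sieve_criterion_small sieve_criterion_large assms(1-3) by (metis not_less)
  then obtain k where k: "k \<in> L.D" "int k mod 4 = 2" "\<forall>r\<in>odd_primes q. \<not> int r dvd int k"
    using R.exists_in_D_if_sieve_criterion by blast
  have k4: "k mod 4 = 2"
  proof -
    have "int (k mod 4) = int 2" using k(2) by (simp add: zmod_int)
    then show ?thesis by (simp only: of_nat_eq_iff)
  qed
  have "gcd E.Q k = 2"
  proof (rule gcd_eq_2I[OF E.Q_pos _ k4])
    show "even E.Q" using assms(1) by (simp add: E.Q_factor)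
    show "\<not> r dvd k" if "prime r" "r \<noteq> 2" "r dvd E.Q" for r
      using that k(3) by (auto simp: odd_primes_def E.Q_def)
  qed
  moreover have "k > 0" using k4 by (cases k) auto
  ultimately have "group.ord (mult_of F) (g [^]\<^bsub>F\<^esub> k) = (q\<^sup>2 - 1) div 2"
    using g(5) by (simp add: E.Q_def)
  then have "two_primitive F q (g [^]\<^bsub>F\<^esub> k)"
    using g(2) by (simp add: two_primitive_def)
  moreover have "quad_trace F q (g [^]\<^bsub>F\<^esub> k) = \<beta>" using k(1) by (simp add: L.D_def)
  ultimately show "\<exists>\<xi> \<in> carrier F. two_primitive F q \<xi> \<and> quad_trace F q \<xi> = \<beta>" by auto
qed

end
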